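(* Let $n\in\{2,3\}$. For generic homogeneous $P\in A_n=\mathbb{C}\langle x_1,\dots,x_n\rangle$, the algebra $A=A_n/\langle P\rangle$, $\Omega^0=A_{ab}$ the abelianization of $A$, $\Omega^1$ the module of Kähler differentials over $A_{ab}$, and $\mathbf{d}:\Omega^0\to\Omega^1$ the differential map, there exists an isomorphism of graded vector spaces $$\phi: B_2(A)\to \Omega^1/\mathbf{d}\Omega^0 .$$
   Context: All algebras are associative, over $\mathbb{C}$, and with a unit. For subspaces $B,C$ of an algebra, $[B,C]$ is the linear span of all $[b,c]=bc-cb$ with $b\in B$, $c\in C$. The lower central series of an algebra $A$ is $L_1(A)=A$, $L_{i+1}(A)=[A,L_i(A)]$ for $i\ge 1$, and $B_i(A)=L_i(A)/L_{i+1}(A)$. The abelianization of $A$ is the commutative algebra $A_{ab}=A/(A[A,A]A)$. $A_n=\mathbb{C}\langle x_1,\dots,x_n\rangle$ is the free algebra on $n$ generators, graded by $\deg x_i=1$, and $\langle P\rangle$ is the two-sided ideal generated by $P$. Since $P$ is homogeneous, $A=A_n/\langle P\rangle$ inherits the grading from $A_n$, and so do $B_2(A)$ and $A_{ab}$. For a commutative algebra $R$, $\Omega^0(R)=R$, and the module of Kähler differentials $\Omega^1(R)$ is the $R$-module with generators $\mathbf{d}f$ ($f\in R$) and relations $\mathbf{d}(fg)=f\,\mathbf{d}g+g\,\mathbf{d}f$, $\mathbf{d}(\alpha f+\beta g)=\alpha\,\mathbf{d}f+\beta\,\mathbf{d}g$ ($\alpha,\beta\in\mathbb{C}$); the map $\mathbf{d}:\Omega^0(R)\to\Omega^1(R)$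 sends $f$ to $\mathbf{d}f$. Here $\Omega^i=\Omega^i(A_{ab})$, graded so that $\mathbf{d}$ is homogeneous, preserving degree (so $\deg\mathbf{d}x_i=1$). *)

theory Defs
  imports
    "HOL-Algebra.Algebraic_Closure_Type"
    "HOL-Library.Cardinality"
    "HOL-Library.Poly_Mapping"
begin

section \<open>Complex algebras as records\<close>

text \<open>
  A unital associative \<open>\<complex>\<close>-algebra is a structure of the library's record type \<open>('r, 'a) module\<close>,
  i.e. a ring together with a scalar multiplication. (The library locale \<open>algebra\<close> is about
  commutative algebras only.) Where such a record stands for a mere module or vector space, its
  \<open>mult\<close> and \<open>one\<close> fields carry no meaning.
\<close>

abbreviation complex_ring :: "complex ring"
  where "complex_ring \<equiv> ring_of_type_algebra"

definition lin_span :: "('r, 's) ring_scheme \<Rightarrow> ('r, 'a, 'm) module_scheme \<Rightarrow> 'a set \<Rightarrow> 'a set"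
  where "lin_span R M S = \<Inter>{H. submodule H R M \<and> S \<subseteq> H}"

text \<open>
  The quotient by \<open>W\<close>: a quotient algebra if \<open>W\<close> is a two-sided ideal of an algebra, and a
  quotient module if \<open>W\<close> is merely a submodule. It is \<open>M Quot W\<close> with the induced scalar action.
\<close>

definition quot :: "('r, 'a) module \<Rightarrow> 'a set \<Rightarrow> ('r, 'a set) module"
  where "quot M W = ring.extend (M Quot W)
    (module.fields (\<lambda>c U. \<Union>x\<in>U. W +>\<^bsub>M\<^esub> (c \<odot>\<^bsub>M\<^esub> x)))"

definition quot_grading :: "('r, 'a) module \<Rightarrow> 'a set \<Rightarrow> (nat \<Rightarrow> 'a set) \<Rightarrow> nat \<Rightarrow> 'a set set"
  where "quot_grading M W G k = (\<lambda>x. W +>\<^bsub>M\<^esub> x) ` G k"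

definition graded_iso ::
    "(complex, 'a) module \<Rightarrow> (nat \<Rightarrow> 'a set) \<Rightarrow>
     (complex, 'b) module \<Rightarrow> (nat \<Rightarrow> 'b set) \<Rightarrow> ('a \<Rightarrow> 'b) \<Rightarrow> bool"
  where "graded_iso M G N H \<phi> \<longleftrightarrow>
    bij_betw \<phi> (carrier M) (carrier N) \<and>
    (\<forall>x\<in>carrier M. \<forall>y\<in>carrier M. \<phi> (x \<oplus>\<^bsub>M\<^esub> y) = \<phi> x \<oplus>\<^bsub>N\<^esub> \<phi> y) \<and>
    (\<forall>c. \<forall>x\<in>carrier M. \<phi> (c \<odot>\<^bsub>M\<^esub> x) = c \<odot>\<^bsub>N\<^esub> \<phi> x) \<and>
    (\<forall>k. \<phi> ` G k = H k)"


section \<open>Lower central series and abelianization\<close>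

definition bracket :: "(complex, 'a) module \<Rightarrow> 'a set \<Rightarrow> 'a set \<Rightarrow> 'a set"
  where "bracket A B C = lin_span complex_ring A
    {b \<otimes>\<^bsub>A\<^esub> c \<ominus>\<^bsub>A\<^esub> c \<otimes>\<^bsub>A\<^esub> b | b c. b \<in> B \<and> c \<in> C}"

text \<open>The series starts at \<open>L 1 = A\<close>; the value at index \<open>0\<close> is a dummy.\<close>

fun lcs :: "(complex, 'a) module \<Rightarrow> nat \<Rightarrow> 'a set"
  where
    "lcs A 0 = carrier A"
  | "lcs A (Suc 0) = carrier A"
  | "lcs A (Suc (Suc i)) = bracket A (carrier A) (lcs A (Suc i))"

definition lcs_quot :: "(complex, 'a) module \<Rightarrow> nat \<Rightarrow> (complex, 'a set) module"
  where "lcs_quot A i = quot (A\<lparr>carrier := lcs A i\<rparr>) (lcs A (Suc i))"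

definition lcs_quot_grading ::
    "(complex, 'a) module \<Rightarrow> (nat \<Rightarrow> 'a set) \<Rightarrow> nat \<Rightarrow> nat \<Rightarrow> 'a set set"
  where "lcs_quot_grading A G i =
    quot_grading (A\<lparr>carrier := lcs A i\<rparr>) (lcs A (Suc i)) (\<lambda>k. lcs A i \<inter> G k)"

definition commutator_ideal :: "(complex, 'a) module \<Rightarrow> 'a set"
  where "commutator_ideal A = lin_span complex_ring A
    {a \<otimes>\<^bsub>A\<^esub> m \<otimes>\<^bsub>A\<^esub> b | a m b.
      a \<in> carrier A \<and> m \<in> bracket A (carrier A) (carrier A) \<and> b \<in> carrier A}"

definition abelianization :: "(complex, 'a) module \<Rightarrow> (complex, 'a set) module"
  where "abelianization A = quot A (commutator_ideal A)"

definition abelianization_grading ::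
    "(complex, 'a) module \<Rightarrow> (nat \<Rightarrow> 'a set) \<Rightarrow> nat \<Rightarrow> 'a set set"
  where "abelianization_grading A G = quot_grading A (commutator_ideal A) G"


section \<open>Kaehler differentials of a commutative algebra\<close>

text \<open>
  \<open>symbol_module R\<close> is the free \<open>R\<close>-module on symbols \<open>df\<close> for \<open>f \<in> carrier R\<close>: finitely supported
  families of coefficients in \<open>R\<close>, where \<open>symb R r f\<close> stands for \<open>r df\<close>.
\<close>

definition symbol_module :: "(complex, 'a) module \<Rightarrow> ('a, 'a \<Rightarrow> 'a) module"
  where "symbol_module R =
    \<lparr>carrier = {u. (\<forall>f. u f \<in> carrier R) \<and> (\<forall>f. f \<notin> carrier R \<longrightarrow> u f = \<zero>\<^bsub>R\<^esub>) \<and>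
                  finite {f. u f \<noteq> \<zero>\<^bsub>R\<^esub>}},
     monoid.mult = undefined, monoid.one = undefined,
     ring.zero = (\<lambda>f. \<zero>\<^bsub>R\<^esub>), ring.add = (\<lambda>u v f. u f \<oplus>\<^bsub>R\<^esub> v f),
     module.smult = (\<lambda>r u f. r \<otimes>\<^bsub>R\<^esub> u f)\<rparr>"

definition symb :: "(complex, 'a) module \<Rightarrow> 'a \<Rightarrow> 'a \<Rightarrow> ('a \<Rightarrow> 'a)"
  where "symb R r f = (\<lambda>g. if g = f then r else \<zero>\<^bsub>R\<^esub>)"

definition kaehler_relations :: "(complex, 'a) module \<Rightarrow> ('a \<Rightarrow> 'a) set"
  where "kaehler_relations R = (let F = symbol_module R in lin_span R F
    ({symb R \<one>\<^bsub>R\<^esub> (f \<otimes>\<^bsub>R\<^esub> g) \<ominus>\<^bsub>F\<^esub> (symb R f g \<oplus>\<^bsub>F\<^esub> symb R g f) | f g.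
        f \<in> carrier R \<and> g \<in> carrier R} \<union>
     {symb R \<one>\<^bsub>R\<^esub> (\<alpha> \<odot>\<^bsub>R\<^esub> f \<oplus>\<^bsub>R\<^esub> \<beta> \<odot>\<^bsub>R\<^esub> g) \<ominus>\<^bsub>F\<^esub>
        (symb R (\<alpha> \<odot>\<^bsub>R\<^esub> \<one>\<^bsub>R\<^esub>) f \<oplus>\<^bsub>F\<^esub> symb R (\<beta> \<odot>\<^bsub>R\<^esub> \<one>\<^bsub>R\<^esub>) g) | \<alpha> \<beta> f g.
        f \<in> carrier R \<and> g \<in> carrier R}))"

definition Omega1 :: "(complex, 'a) module \<Rightarrow> ('a, ('a \<Rightarrow> 'a) set) module"
  where "Omega1 R = quot (symbol_module R) (kaehler_relations R)"

definition kaehler_d :: "(complex, 'a) module \<Rightarrow> 'a \<Rightarrow> ('a \<Rightarrow> 'a) set"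
  where "kaehler_d R f = kaehler_relations R +>\<^bsub>symbol_module R\<^esub> symb R \<one>\<^bsub>R\<^esub> f"

text \<open>\<open>\<Omega>\<^sup>1\<close> with scalars restricted along \<open>c \<mapsto> c 1\<close>.\<close>

definition Omega1_space :: "(complex, 'a) module \<Rightarrow> (complex, ('a \<Rightarrow> 'a) set) module"
  where "Omega1_space R = ring.extend (ring.truncate (Omega1 R))
    (module.fields (\<lambda>c \<omega>. (c \<odot>\<^bsub>R\<^esub> \<one>\<^bsub>R\<^esub>) \<odot>\<^bsub>Omega1 R\<^esub> \<omega>))"

text \<open>The grading of \<open>\<Omega>\<^sup>1\<close> determined by \<open>deg (f dg) = deg f + deg g\<close>.\<close>

definition Omega1_grading ::
    "(complex, 'a) module \<Rightarrow> (nat \<Rightarrow> 'a set) \<Rightarrow> nat \<Rightarrow> ('a \<Rightarrow> 'a) set set"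
  where "Omega1_grading R G k = lin_span complex_ring (Omega1_space R)
    {f \<odot>\<^bsub>Omega1 R\<^esub> kaehler_d R g | f g i j. f \<in> G i \<and> g \<in> G j \<and> i + j = k}"

definition Omega1_mod_exact :: "(complex, 'a) module \<Rightarrow> (complex, ('a \<Rightarrow> 'a) set set) module"
  where "Omega1_mod_exact R = quot (Omega1_space R) (kaehler_d R ` carrier R)"

definition Omega1_mod_exact_grading ::
    "(complex, 'a) module \<Rightarrow> (nat \<Rightarrow> 'a set) \<Rightarrow> nat \<Rightarrow> ('a \<Rightarrow> 'a) set set set"
  where "Omega1_mod_exact_grading R G =
    quot_grading (Omega1_space R) (kaehler_d R ` carrier R) (Omega1_grading R G)"


section \<open>The free algebra and its quotients by one homogeneous relation\<close>

text \<open>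
  The free algebra on generators indexed by \<open>'n\<close> is the monoid algebra of the free monoid of words
  over \<open>'n\<close>. \<open>Poly_Mapping\<close> multiplies by adding exponents, so the free monoid is written
  additively although it is not commutative.
\<close>

datatype 'n free_monoid = Word (letters: "'n list")

instantiation free_monoid :: (type) monoid_add
begin
definition "0 = Word []"
definition "u + v = Word (letters u @ letters v)"
instance by standard (simp_all add: zero_free_monoid_def plus_free_monoid_def)
end

type_synonym 'n nc_poly = "'n free_monoid \<Rightarrow>\<^sub>0 complex"

definition free_algebra :: "(complex, 'n nc_poly) module"
  where "free_algebra = ring.extend ring_of_type_algebra
    (module.fields (\<lambda>c. Poly_Mapping.map ((*) c)))"

definition homogeneous :: "nat \<Rightarrow> 'n nc_poly set"
  where "homogeneous d = {P. \<forall>w\<in>Poly_Mapping.keys P. length (letters w) = d}"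

definition one_relator :: "'n nc_poly \<Rightarrow> (complex, 'n nc_poly set) module"
  where "one_relator P = quot free_algebra (genideal free_algebra {P})"

definition one_relator_grading :: "'n nc_poly \<Rightarrow> nat \<Rightarrow> 'n nc_poly set set"
  where "one_relator_grading P = quot_grading free_algebra (genideal free_algebra {P}) homogeneous"


section \<open>Generic homogeneous elements\<close>

text \<open>
  \<open>homogeneous d\<close> is a finite-dimensional affine space, with the coefficients of the words of
  length \<open>d\<close> as coordinates. A property holds for generic \<open>P\<close> of degree \<open>d\<close> if it holds outside a
  proper Zariski closed subset of this space.
\<close>

inductive_set polynomial_functions :: "('n nc_poly \<Rightarrow> complex) set"
  where
    const: "(\<lambda>P. c) \<in> polynomial_functions"
  | coord: "(\<lambda>P. Poly_Mapping.lookup P w) \<in> polynomial_functions"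
  | add: "F \<in> polynomial_functions \<Longrightarrow> G \<in> polynomial_functions \<Longrightarrow>
      (\<lambda>P. F P + G P) \<in> polynomial_functions"
  | mult: "F \<in> polynomial_functions \<Longrightarrow> G \<in> polynomial_functions \<Longrightarrow>
      (\<lambda>P. F P * G P) \<in> polynomial_functions"

definition zariski_closed :: "nat \<Rightarrow> 'n nc_poly set \<Rightarrow> bool"
  where "zariski_closed d Z \<longleftrightarrow>
    (\<exists>S \<subseteq> polynomial_functions. Z = {P \<in> homogeneous d. \<forall>F\<in>S. F P = 0})"

definition for_generic_homogeneous :: "nat \<Rightarrow> ('n nc_poly \<Rightarrow> bool) \<Rightarrow> bool"
  where "for_generic_homogeneous d Q \<longleftrightarrow>
    (\<exists>Z. zariski_closed d Z \<and> Z \<subset> homogeneous d \<and> (\<forall>P \<in> homogeneous d - Z. Q P))"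

end

theory Submission
  imports Defs
begin

text \<open>
  Write \<open>F\<close> for the free algebra, \<open>I\<close> for the ideal of \<open>P\<close>, \<open>L\<^sub>2\<close>, \<open>L\<^sub>3\<close> for the lower central series
  of \<open>F\<close>, \<open>M\<^sub>2\<close> for its commutator ideal and \<open>R = F/(M\<^sub>2 + I)\<close> for the abelianization of \<open>A = F/I\<close>.
  The isomorphism matches \<open>[a, b]\<close> with the class of \<open>a db\<close>.

  That \<open>a db \<mapsto> [a, b]\<close> is well defined modulo \<open>L\<^sub>3 + I\<close> amounts to \<open>[M\<^sub>2, F] \<subseteq> L\<^sub>3\<close>, which holds for at
  most three generators because \<open>[a [b, c], e]\<close> behaves modulo \<open>L\<^sub>3\<close> like the \<open>4\<close>-form
  \<open>da db dc de\<close>.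

  For the converse, a linear functional on \<open>\<Omega>\<^sup>1(R)/dR\<close> is a bilinear map \<open>b\<close> with
  \<open>b(x, yz) = b(xy, z) + b(zx, y)\<close> and \<open>b(1, x) = 0\<close>. On \<open>F\<close> such a \<open>b\<close> has a potential \<open>D\<close>, that is, a linear
  functional with \<open>D[x, y] = b(x, y)\<close>, given by an explicit formula that involves division by the
  degree. It kills \<open>L\<^sub>3\<close>, and it remains to see that it kills \<open>I \<inter> L\<^sub>2\<close>. Modulo \<open>[F, I]\<close> an element of
  this intersection is some \<open>Pw\<close>; its image in the polynomial ring vanishes, so if \<open>P\<close> has nonzero
  image there, then \<open>w\<close> maps to \<open>0\<close>, and the formula for \<open>D\<close> gives \<open>D(Pw) = 0\<close>.
  Genericity is needed only for the image of \<open>P\<close> in the polynomial ring to be nonzero.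
\<close>

section \<open>Linear functionals and the free algebra\<close>

text \<open>A basis of \<open>N\<close> stays independent when \<open>x\<close> is added, so a
  functional can be prescribed as \<open>1\<close> at \<open>x\<close> and \<open>0\<close> on the
  basis. Both membership in \<open>L3\<close> and exactness of symbols are tested by such
  functionals.\<close>

lemma (in vector_space) subspace_separation:
  assumes "subspace N" "x \<notin> N"
  shows "\<exists>f. Vector_Spaces.linear scale (*) f \<and> (\<forall>y\<in>N. f y = 0) \<and> f x \<noteq> 0"
proof -
  interpret p: vector_space_pair scale "(*) :: 'a \<Rightarrow> 'a \<Rightarrow> 'a"
    by unfold_locales (auto simp: algebra_simps)
  obtain B where B: "B \<subseteq> N" "independent B" "N \<subseteq> span B"
    by (rule maximal_independent_subset)
  have "span B \<subseteq> N" using B(1) assms(1) by (rule span_minimal)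
  hence x: "x \<notin> span B" using assms(2) by auto
  hence "independent (insert x B)" using B(2) by (simp add: independent_insert)
  then obtain f where f: "Vector_Spaces.linear scale (*) f"
      "\<forall>y\<in>insert x B. f y = (if y = x then 1 else 0)"
    using p.linear_independent_extend[of "insert x B" "\<lambda>y. if y = x then 1 else 0"] by blast
  have "x \<notin> B" using x span_superset by auto
  hence *: "\<forall>y\<in>B. f y = 0" using f(2) by auto
  interpret f: Vector_Spaces.linear scale "(*)" f by fact
  have "f y = 0" if "y \<in> N" for y
    using f.eq_0_on_span[of B y] * B(3) that by auto
  moreover have "f x \<noteq> 0" using f(2) by simp
  ultimately show ?thesis using f(1) by blast
qed

abbreviation (input) sc :: "complex \<Rightarrow> 'n nc_poly \<Rightarrow> 'n nc_poly"
  where "sc c \<equiv> Poly_Mapping.map ((*) c)"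

lemma sc_conv_mult: "sc c a = Poly_Mapping.single 0 c * a"
  by (rule mult_map_scale_conv_mult)

lemma lookup_map_times:
  "Poly_Mapping.lookup (Poly_Mapping.map ((*) c) a) w = c * Poly_Mapping.lookup a (w :: 'k)"
  for c :: "'b :: semiring_0"
  by (simp add: map.rep_eq when_def)

global_interpretation nc: vector_space "\<lambda>c. Poly_Mapping.map ((*) c) :: 'n nc_poly \<Rightarrow> 'n nc_poly"
  by unfold_locales (auto intro!: poly_mapping_eqI simp: lookup_map_times lookup_add algebra_simps)

lemma poly_mapping_eq_sum_single:
  "a = (\<Sum>w\<in>Poly_Mapping.keys a. Poly_Mapping.single w (Poly_Mapping.lookup a w))"
proof (rule poly_mapping_eqI)
  fix v
  have "(\<Sum>w\<in>Poly_Mapping.keys a. Poly_Mapping.lookup (Poly_Mapping.single w (Poly_Mapping.lookup a w)) v) =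
        (\<Sum>w\<in>Poly_Mapping.keys a. if w = v then Poly_Mapping.lookup a v else 0)"
    by (intro sum.cong) (auto simp: lookup_single when_def)
  also have "\<dots> = Poly_Mapping.lookup a v"
    by (auto simp: in_keys_iff)
  finally show "Poly_Mapping.lookup a v = Poly_Mapping.lookup
      (\<Sum>w\<in>Poly_Mapping.keys a. Poly_Mapping.single w (Poly_Mapping.lookup a w)) v"
    by (simp add: lookup_sum)
qed

lemma scalar_central: "Poly_Mapping.single 0 c * (a :: 'n nc_poly) = a * Poly_Mapping.single 0 c"
  by (subst (1 2) poly_mapping_eq_sum_single[of a])
    (simp add: sum_distrib_left sum_distrib_right mult_single mult.commute)

lemma sc_mult_left: "sc c a * b = sc c (a * b)"
  by (simp add: sc_conv_mult mult.assoc)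

lemma sc_mult_right: "a * sc c b = sc c (a * b)"
  unfolding sc_conv_mult by (metis scalar_central mult.assoc)

definition ncmon :: "'n list \<Rightarrow> 'n nc_poly"
  where "ncmon w = Poly_Mapping.single (Word w) 1"

lemma ncmon_Nil [simp]: "ncmon [] = 1"
  by (simp add: ncmon_def flip: zero_free_monoid_def)

lemma ncmon_append: "ncmon (u @ v) = ncmon u * ncmon v"
  by (simp add: ncmon_def mult_single plus_free_monoid_def)

lemma ncmon_Cons: "ncmon (x # w) = ncmon [x] * ncmon w"
  using ncmon_append[of "[x]" w] by simp

lemma single_eq_sc_ncmon: "Poly_Mapping.single w c = sc c (ncmon (letters w))"
  by (simp add: ncmon_def)

lemma nc_poly_eq_sum_ncmon:
  "a = (\<Sum>w\<in>Poly_Mapping.keys a. sc (Poly_Mapping.lookup a w) (ncmon (letters w)))"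
  unfolding single_eq_sc_ncmon[symmetric] by (rule poly_mapping_eq_sum_single)

lemma nc_subspace_ncmon_UNIV:
  assumes "nc.subspace S" "\<And>w. ncmon w \<in> S"
  shows "a \<in> S"
  by (subst nc_poly_eq_sum_ncmon)
    (intro nc.subspace_sum nc.subspace_scale assms(2) assms(1))

lemma nc_linear_eq_0:
  assumes "\<And>a b. f (a + b) = f a + f b" "\<And>c a. f (sc c a) = c * f a"
    and "\<And>w. f (ncmon w) = (0 :: complex)"
  shows "f a = 0"
proof -
  have "f 0 = 0" using assms(1)[of 0 0] by simp
  hence "nc.subspace {a. f a = 0}"
    by (intro nc.subspaceI) (auto simp: assms)
  from nc_subspace_ncmon_UNIV[OF this, of a] show ?thesis by (simp add: assms(3))
qed

section \<open>Triple commutators\<close>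

definition commutator :: "'a :: ring \<Rightarrow> 'a \<Rightarrow> 'a"
  where "commutator a b = a * b - b * a"

text \<open>Statements modulo triple commutators are proved as statements about the values of
  additive functionals that kill them.\<close>

locale lie_trace =
  fixes t :: "'a :: ring_1 \<Rightarrow> complex"
  assumes add: "t (a + b) = t a + t b"
    and triple: "t (commutator (commutator a b) c) = 0"
begin

lemma zero: "t 0 = 0"
  using add[of 0 0] by simp

lemma uminus: "t (- a) = - t a"
  using add[of a "- a"] by (simp add: zero eq_neg_iff_add_eq_0 add.commute)

lemma diff: "t (a - b) = t a - t b"
  using add[of a "- b"] by (simp add: uminus)

definition Q where "Q a b c e = t (commutator (a * commutator b c) e)"

lemma commutator_anti: "t (commutator a b) = - t (commutator b a)"
  by (simp add: commutator_def diff)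

text \<open>An identity of commutators even before \<open>t\<close> is applied; under
  \<open>a db \<mapsto> [a, b]\<close> it is the product rule for \<open>a d(bc)\<close>.\<close>

lemma cyclic: "t (commutator a (b * c)) = t (commutator (a * b) c) + t (commutator (c * a) b)"
  by (simp add: commutator_def diff mult.assoc)

lemma trace: "t (commutator (a * b) e) = t (commutator (b * a) e)"
proof -
  have "t (commutator (commutator a b) e) = t (commutator (a * b) e) - t (commutator (b * a) e)"
    by (simp add: commutator_def algebra_simps flip: diff)
  thus ?thesis by (simp add: triple)
qed

lemma Q_swap23: "Q a c b e = - Q a b c e"
  by (simp add: Q_def commutator_def diff algebra_simps)

text \<open>Apply \<open>cyclic\<close> to \<open>[a, [b, c] e]\<close>: the term
  \<open>[e a, [b, c]]\<close> is a triple commutator, and \<open>trace\<close> turns the left side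
  into \<open>- Q e b c a\<close>.\<close>

lemma Q_swap14: "Q e b c a = - Q a b c e"
proof -
  have "t (commutator a (commutator b c * e)) =
      t (commutator (a * commutator b c) e) + t (commutator (e * a) (commutator b c))"
    by (rule cyclic)
  also have "t (commutator (e * a) (commutator b c)) = 0"
    using commutator_anti[of "e * a" "commutator b c"] triple by simp
  finally have "t (commutator a (commutator b c * e)) = Q a b c e"
    by (simp add: Q_def)
  moreover have "t (commutator a (commutator b c * e)) = - Q e b c a"
    unfolding Q_def trace[of e, symmetric] by (subst commutator_anti) (simp only: trace[of e])
  ultimately show ?thesis by (metis minus_minus)
qed

text \<open>\<open>a [b, c] - b [c, a]\<close> equals \<open>[a, b c] - [a c, b]\<close>, a
  combination of commutators, so \<open>t\<close> kills its bracket with \<open>e\<close>.\<close>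

lemma Q_rotate: "Q b c a e = Q a b c e"
proof -
  have "commutator (a * commutator b c) e - commutator (b * commutator c a) e =
      commutator (commutator a (b * c)) e - commutator (commutator (a * c) b) e"
    by (simp add: commutator_def algebra_simps)
  from arg_cong[OF this, of t] show ?thesis
    by (simp add: Q_def diff triple)
qed

text \<open>Together with (2 3) and (1 4) this transposition generates all permutations:
  \<open>Q\<close> is alternating in its four arguments.\<close>

lemma Q_swap12: "Q b a c e = - Q a b c e"
  using Q_rotate[of a c b e] Q_swap23[of a b c e] Q_rotate[of a b c e] Q_swap23[of b c a e] by simp

lemma Q_swap24: "Q a e c b = - Q a b c e"
  by (metis Q_swap12 Q_swap14)

lemma Q_swap34: "Q a b e c = - Q a b c e"
  by (metis Q_swap23 Q_swap24)

text \<open>A commutator in the first argument can be moved to the last by \<open>Q_swap14\<close>,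
  where it produces a triple commutator.\<close>

lemma Q_trace: "Q (u * v) b c e = Q (v * u) b c e"
proof -
  have "Q e b c (commutator u v) = 0"
    using commutator_anti[of "e * commutator b c" "commutator u v"] triple
    by (simp add: Q_def)
  hence "Q (commutator u v) b c e = 0"
    by (simp add: Q_swap14[of e])
  moreover have "Q (commutator u v) b c e = Q (u * v) b c e - Q (v * u) b c e"
    unfolding Q_def diff[symmetric] by (rule arg_cong[of _ _ t]) (simp add: commutator_def algebra_simps)
  ultimately show ?thesis by simp
qed

text \<open>In terms of forms, \<open>db d(a^(k+1)) = (k+1) a^k db da\<close>, and
  \<open>a^k\<close> may be absorbed into \<open>d(a^k b)\<close> because
  \<open>d(a^k) da = 0\<close>. The induction splits \<open>[a a^(k+1), c]\<close> by the Leibniz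
  rule.\<close>

lemma Q_power: "Q b (a ^ Suc k) c e = of_nat (Suc k) * Q (a ^ k * b) a c e"
proof (induction k arbitrary: b)
  case 0
  show ?case by simp
next
  case (Suc k)
  have "Q b (a ^ Suc (Suc k)) c e =
      Q (b * a) (a ^ Suc k) c e + t (commutator ((b * commutator a c) * a ^ Suc k) e)"
    unfolding Q_def power_Suc[of a "Suc k"] add[symmetric]
    by (rule arg_cong[of _ _ t]) (simp add: commutator_def algebra_simps del: power_Suc)
  also have "t (commutator ((b * commutator a c) * a ^ Suc k) e) = Q (a ^ Suc k * b) a c e"
    using trace[of "b * commutator a c" "a ^ Suc k" e] by (simp only: Q_def mult.assoc)
  also have "Q (b * a) (a ^ Suc k) c e = of_nat (Suc k) * Q (a ^ k * b * a) a c e"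
    by (simp only: Suc.IH mult.assoc)
  also have "Q (a ^ k * b * a) a c e = Q (a ^ Suc k * b) a c e"
    using Q_trace[of "a ^ k * b" a a c e] by (simp only: power_Suc mult.assoc)
  finally show ?case by (simp add: algebra_simps)
qed

text \<open>
  In terms of differential forms, \<open>Q a b c e\<close> is \<open>da db dc de\<close>, and this lemma expresses that
  \<open>x da d(x ^ (k + 1)) dc de\<close> is proportional to \<open>da d(x ^ (k + 2)) dc de\<close>.
\<close>

lemma Q_shift:
  assumes "Q a (x ^ Suc (Suc k)) c e = 0"
  shows "Q (x * a) (x ^ Suc k) c e = 0"
proof -
  have "of_nat (Suc (Suc k)) * Q (x ^ Suc k * a) x c e = 0"
    using assms by (simp only: Q_power)
  hence "Q (x ^ Suc k * a) x c e = 0"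
    by (simp del: of_nat_Suc)
  moreover have "x ^ k * (x * a) = x ^ Suc k * a"
    by (simp only: power_Suc2 mult.assoc)
  ultimately show ?thesis
    by (simp only: Q_power mult_zero_right)
qed

end

text \<open>If two of the letters agree, two arguments commute and antisymmetry gives
  \<open>0\<close>. Otherwise \<open>i\<close>, \<open>j\<close>, \<open>k\<close> are all the
  letters, so the first letter of the word is one of them, and \<open>Q_shift\<close> trades it for
  a higher power of that letter. Hence the exponents vary in the induction; the empty word gives a
  triple commutator.\<close>

lemma Q_powers_eq_0:
  fixes t :: "'n::finite nc_poly \<Rightarrow> complex"
  assumes "CARD('n) \<le> 3" "lie_trace t"
  shows "lie_trace.Q t (ncmon w) (ncmon [i] ^ Suc p) (ncmon [j] ^ Suc q) (ncmon [k] ^ Suc r) = 0"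
proof -
  interpret lie_trace t by fact
  show ?thesis
  proof (induction w arbitrary: p q r)
    case Nil
    show ?case
      by (simp add: Q_def triple zero)
  next
    case (Cons l w)
    show ?case
    proof (cases "i = j \<or> j = k \<or> i = k")
      case True
      have 0: "Q a (ncmon [i] ^ m) (ncmon [i] ^ n) e = 0" for a m n i e
        by (simp add: Q_def commutator_def zero flip: power_add) (simp add: add.commute zero)
      show ?thesis
        using True 0 Q_swap24[of "ncmon (l # w)" "ncmon [k] ^ Suc r"] Q_swap34[of "ncmon (l # w)"]
        by (metis neg_equal_0_iff_equal)
    next
      case False
      have "card {i, j, k} = 3" using False by auto
      hence "{i, j, k} = UNIV"
        using assms(1) by (intro card_seteq) auto
      then consider "l = i" | "l = j" | "l = k" by auto
      thus ?thesis
      proof cases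
        case 1
        show ?thesis
          unfolding 1 ncmon_Cons[of i w] by (intro Q_shift Cons.IH)
      next
        case 2
        have "Q (ncmon w) (ncmon [j] ^ Suc (Suc q)) (ncmon [i] ^ Suc p) (ncmon [k] ^ Suc r) = 0"
          by (subst Q_swap23) (simp only: Cons.IH minus_zero)
        hence "Q (ncmon (l # w)) (ncmon [j] ^ Suc q) (ncmon [i] ^ Suc p) (ncmon [k] ^ Suc r) = 0"
          unfolding 2 ncmon_Cons[of j w] by (rule Q_shift)
        thus ?thesis
          by (subst Q_swap23) simp
      next
        case 3
        have "Q (ncmon w) (ncmon [k] ^ Suc (Suc r)) (ncmon [j] ^ Suc q) (ncmon [i] ^ Suc p) = 0"
          by (subst Q_swap24) (simp only: Cons.IH minus_zero)
        hence "Q (ncmon (l # w)) (ncmon [k] ^ Suc r) (ncmon [j] ^ Suc q) (ncmon [i] ^ Suc p) = 0"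
          unfolding 3 ncmon_Cons[of k w] by (rule Q_shift)
        thus ?thesis
          by (subst Q_swap24) simp
      qed
    qed
  qed
qed

text \<open>Letters are split off the last argument by \<open>cyclic\<close>. What is split off
  multiplies the first argument, so \<open>a\<close> has to vary both in the hypothesis and in the
  induction.\<close>

lemma Q_last_arbitrary:
  fixes t :: "'n nc_poly \<Rightarrow> complex"
  assumes "lie_trace t" "\<And>c a. t (sc c a) = c * t a"
    and "\<And>a i. lie_trace.Q t a b c (ncmon [i]) = 0"
  shows "lie_trace.Q t a b c e = 0"
proof -
  interpret lie_trace t by fact
  show ?thesis
  proof (rule nc_linear_eq_0[where f = "\<lambda>e. Q a b c e"])
    fix e
    show "Q a b c (ncmon e) = 0"
    proof (induction e arbitrary: a)
      case Nil
      show ?case by (simp add: Q_def commutator_def zero)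
    next
      case (Cons i e)
      have "Q a b c (ncmon (i # e)) =
          t (commutator ((a * commutator b c) * ncmon [i]) (ncmon e)) +
          t (commutator (ncmon e * (a * commutator b c)) (ncmon [i]))"
        unfolding Q_def ncmon_Cons[of i e] by (rule cyclic)
      also have "\<dots> = Q (ncmon [i] * a) b c (ncmon e) + Q (ncmon e * a) b c (ncmon [i])"
        unfolding Q_def
        using trace[of "a * commutator b c" "ncmon [i]" "ncmon e"] by (simp add: mult.assoc)
      finally show ?case using assms(3) Cons.IH by simp
    qed
  next
    fix x y show "Q a b c (x + y) = Q a b c x + Q a b c y"
      by (simp add: Q_def commutator_def algebra_simps add diff)
  next
    fix k x show "Q a b c (sc k x) = k * Q a b c x"
      by (simp add: Q_def commutator_def diff sc_mult_left sc_mult_right assms(2) flip: nc.scale_right_diff_distrib)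
  qed
qed

text \<open>Start from letters in the last three arguments. Antisymmetry brings each of them in turn
  to the last position, where \<open>Q_last_arbitrary\<close> frees it.\<close>

lemma Q_eq_0:
  fixes t :: "'n::finite nc_poly \<Rightarrow> complex"
  assumes "CARD('n) \<le> 3" "lie_trace t" "\<And>c a. t (sc c a) = c * t a"
  shows "lie_trace.Q t a b c e = 0"
proof -
  interpret lie_trace t by fact
  note arb = Q_last_arbitrary[OF assms(2,3)]
  have "Q a (ncmon [i]) (ncmon [j]) (ncmon [k]) = 0" for a i j k
  proof (rule nc_linear_eq_0[where f = "\<lambda>a. Q a (ncmon [i]) (ncmon [j]) (ncmon [k])"])
    fix w
    show "Q (ncmon w) (ncmon [i]) (ncmon [j]) (ncmon [k]) = 0"
      using Q_powers_eq_0[OF assms(1,2), of w i 0 j 0 k 0] by simp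
  next
    fix x y show "Q (x + y) (ncmon [i]) (ncmon [j]) (ncmon [k]) =
        Q x (ncmon [i]) (ncmon [j]) (ncmon [k]) + Q y (ncmon [i]) (ncmon [j]) (ncmon [k])"
      by (simp add: Q_def commutator_def algebra_simps add diff)
  next
    fix c x show "Q (sc c x) (ncmon [i]) (ncmon [j]) (ncmon [k]) =
        c * Q x (ncmon [i]) (ncmon [j]) (ncmon [k])"
      by (simp add: Q_def commutator_def diff sc_mult_left sc_mult_right assms(3) flip: nc.scale_right_diff_distrib)
  qed
  hence "Q a (ncmon [i]) (ncmon [j]) e = 0" for a i j e
    by (rule arb)
  hence "Q a (ncmon [i]) e (ncmon [j]) = 0" for a i j e
    by (subst Q_swap34) simp
  hence "Q a (ncmon [i]) b c = 0" for a i b c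
    by (rule arb)
  hence "Q a c b (ncmon [i]) = 0" for a i b c
    by (subst Q_swap24) simp
  thus ?thesis
    by (rule arb)
qed

section \<open>Functionals prescribed on a basis\<close>

definition lin_ext :: "('k \<Rightarrow> complex) \<Rightarrow> ('k \<Rightarrow>\<^sub>0 complex) \<Rightarrow> complex"
  where "lin_ext g a = (\<Sum>k\<in>Poly_Mapping.keys a. Poly_Mapping.lookup a k * g k)"

lemma lin_ext_add: "lin_ext g (a + b) = lin_ext g a + lin_ext g b"
  unfolding lin_ext_def by (rule setsum_keys_plus_distrib) (auto simp: algebra_simps)

lemma lin_ext_single [simp]: "lin_ext g (Poly_Mapping.single k c) = c * g k"
  by (simp add: lin_ext_def)

lemma lin_ext_map: "lin_ext g (Poly_Mapping.map ((*) c) a) = c * lin_ext g a"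
  by (cases "c = 0")
    (auto simp: lin_ext_def lookup_map_times sum_distrib_left mult.assoc in_keys_iff
      intro!: sum.cong)

lemma lin_ext_sum: "lin_ext g (sum f A) = (\<Sum>x\<in>A. lin_ext g (f x))"
  by (induction A rule: infinite_finite_induct) (simp_all add: lin_ext_add, simp_all add: lin_ext_def)

section \<open>Abelianization of the free algebra\<close>

definition exponents :: "('n \<Rightarrow> nat) \<Rightarrow> 'n list \<Rightarrow> nat \<Rightarrow>\<^sub>0 nat"
  where "exponents idx w = (\<Sum>x\<leftarrow>w. Poly_Mapping.single (idx x) 1)"

lemma exponents_append: "exponents idx (u @ v) = exponents idx u + exponents idx v"
  by (simp add: exponents_def)

lemma lookup_exponents:
  assumes "inj idx"
  shows "Poly_Mapping.lookup (exponents idx w) (idx x) = count (mset w) x"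
  by (induction w)
    (auto simp: exponents_def lookup_add lookup_single when_def inj_eq[OF assms])

lemma exponents_eqD:
  assumes "inj idx" "exponents idx u = exponents idx v"
  shows "mset u = mset v"
  by (rule multiset_eqI) (metis assms lookup_exponents)

text \<open>The abelianization map of the free algebra. Numbering the letters by \<open>idx\<close>
  gives linearly ordered exponent vectors, so the type of polynomials has no zero divisors and a
  nonzero \<open>ab idx P\<close> can be cancelled.\<close>

definition ab :: "('n \<Rightarrow> nat) \<Rightarrow> 'n nc_poly \<Rightarrow> (nat \<Rightarrow>\<^sub>0 nat) \<Rightarrow>\<^sub>0 complex"
  where "ab idx a = (\<Sum>w\<in>Poly_Mapping.keys a.
    Poly_Mapping.single (exponents idx (letters w)) (Poly_Mapping.lookup a w))"

lemma ab_add: "ab idx (a + b) = ab idx a + ab idx b"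
  unfolding ab_def by (rule setsum_keys_plus_distrib) (auto simp: single_add)

lemma ab_sc: "ab idx (sc c a) = Poly_Mapping.single 0 c * ab idx a"
  by (cases "c = 0")
    (auto simp: ab_def lookup_map_times sum_distrib_left mult_single in_keys_iff intro!: sum.cong)

lemma ab_ncmon: "ab idx (ncmon w) = Poly_Mapping.single (exponents idx w) 1"
  by (simp add: ab_def ncmon_def)

lemma ab_zero: "ab idx 0 = 0"
  by (simp add: ab_def)

text \<open>The map \<open>s\<close> describes how scalars act on the target: it is the identity for
  functionals and \<open>Poly_Mapping.single 0\<close> for polynomial values.\<close>

lemma nc_hom_eqI:
  assumes "\<And>a b. f (a + b) = f a + f b" "\<And>a b. g (a + b) = g a + (g b :: 'b :: ring)"
    and "\<And>c a. f (sc c a) = s c * f a" "\<And>c a. g (sc c a) = s c * g a"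
    and "\<And>w. f (ncmon w) = g (ncmon w)"
  shows "f a = g a"
proof -
  have "f 0 = 0" "g 0 = 0" using assms(1)[of 0 0] assms(2)[of 0 0] by simp_all
  hence "nc.subspace {a. f a = g a}"
    by (intro nc.subspaceI) (auto simp: assms(1-4))
  from nc_subspace_ncmon_UNIV[OF this, of a] show ?thesis by (simp add: assms(5))
qed

lemma ab_mult: "ab idx (a * b) = ab idx a * ab idx b"
proof (rule nc_hom_eqI[where f = "\<lambda>a. ab idx (a * b)" and s = "Poly_Mapping.single 0"])
  fix w
  show "ab idx (ncmon w * b) = ab idx (ncmon w) * ab idx b"
    by (rule nc_hom_eqI[where f = "\<lambda>b. ab idx (ncmon w * b)" and s = "Poly_Mapping.single 0"])
      (simp_all add: ab_add ab_sc algebra_simps sc_mult_right ab_ncmon mult_single exponents_append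
        flip: ncmon_append)
qed (auto simp: ab_add ab_sc algebra_simps sc_mult_left)

lemma ab_diff: "ab idx (a - b) = ab idx a - ab idx b"
  using ab_add[of idx "a - b" b] by simp

lemma ab_commutator: "ab idx (commutator a b) = 0"
  by (simp add: commutator_def ab_diff ab_mult mult.commute)

text \<open>No other word has the same letters with multiplicity as \<open>x^d\<close>, so no
  cancellation can occur at this coefficient.\<close>

lemma lookup_ab_power:
  assumes "inj idx"
  shows "Poly_Mapping.lookup (ab idx a) (exponents idx (replicate d x)) =
    Poly_Mapping.lookup a (Word (replicate d x))"
proof -
  have *: "exponents idx (letters w) = exponents idx (replicate d x) \<longleftrightarrow> w = Word (replicate d x)" for w
  proof
    assume "exponents idx (letters w) = exponents idx (replicate d x)"
    hence "mset (letters w) = mset (replicate d x)"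
      by (rule exponents_eqD[OF assms])
    hence "length (letters w) = length (replicate d x)" "set (letters w) = set (replicate d x)"
      by (rule mset_eq_length, rule mset_eq_setD)
    hence "letters w = replicate d x"
      by (intro replicate_eqI) (auto simp: set_replicate_conv_if split: if_splits)
    thus "w = Word (replicate d x)"
      by (cases w) simp
  qed simp
  show ?thesis
    by (auto simp: ab_def lookup_sum lookup_single when_def * in_keys_iff)
qed

text \<open>Such a \<open>g\<close> factors through \<open>ab idx\<close> as \<open>h\<close>, which
  evaluates \<open>g\<close> at a chosen word for each exponent vector. Vectors realized by no word
  do not occur in the image, so the arbitrary choice there is harmless.\<close>

lemma ab_eq_0_imp:
  fixes g :: "'n nc_poly \<Rightarrow> complex"
  assumes "inj idx" "\<And>a b. g (a + b) = g a + g b" "\<And>c a. g (sc c a) = c * g a"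
    and "\<And>u v. mset u = mset v \<Longrightarrow> g (ncmon u) = g (ncmon v)"
    and "ab idx a = 0"
  shows "g a = 0"
proof -
  define h where "h = lin_ext (\<lambda>m. g (ncmon (SOME w. exponents idx w = m)))"
  have "h (ab idx a) = g a"
  proof (rule nc_hom_eqI[where f = "\<lambda>a. h (ab idx a)" and s = "\<lambda>c. c"])
    fix w
    have "exponents idx (SOME v. exponents idx v = exponents idx w) = exponents idx w"
      by (rule someI) simp
    thus "h (ab idx (ncmon w)) = g (ncmon w)"
      by (auto simp: h_def ab_ncmon intro!: assms(4) exponents_eqD[OF assms(1)])
  qed (simp_all add: h_def ab_add lin_ext_add ab_sc lin_ext_map assms(2,3) flip: mult_map_scale_conv_mult)
  thus ?thesis using assms(5) by (simp add: h_def lin_ext_def)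
qed

section \<open>Commutator subspaces and ideals of the free algebra\<close>

definition L2 :: "'n nc_poly set"
  where "L2 = nc.span {commutator a b |a b. True}"

definition L3 :: "'n nc_poly set"
  where "L3 = nc.span {commutator a x |a x. x \<in> L2}"

definition M2 :: "'n nc_poly set"
  where "M2 = nc.span {a * m * b |a m b. m \<in> L2}"

definition ideal_of :: "'n nc_poly \<Rightarrow> 'n nc_poly set"
  where "ideal_of P = nc.span {u * P * v |u v. True}"

lemma subspace_L2: "nc.subspace L2"
  by (simp add: L2_def)

lemma subspace_L3: "nc.subspace L3"
  by (simp add: L3_def)

lemma subspace_M2: "nc.subspace M2"
  by (simp add: M2_def)

lemma subspace_ideal_of: "nc.subspace (ideal_of P)"
  by (simp add: ideal_of_def)

lemma commutator_in_L2: "commutator a b \<in> L2"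
  unfolding L2_def by (rule nc.span_base) blast

lemma sandwich_in_M2: "m \<in> L2 \<Longrightarrow> a * m * b \<in> M2"
  unfolding M2_def by (rule nc.span_base) blast

lemma sandwich_in_ideal_of: "a * P * b \<in> ideal_of P"
  unfolding ideal_of_def by (rule nc.span_base) blast

lemma L2_subset_M2: "L2 \<subseteq> M2"
  using sandwich_in_M2[of _ 1 1] by auto

lemma M2_mult:
  assumes "k \<in> M2"
  shows "a * k \<in> M2" "k * a \<in> M2"
proof -
  have sub: "nc.subspace {k. a * k \<in> M2 \<and> k * a \<in> M2}"
    by (intro nc.subspaceI)
      (auto simp: distrib_left distrib_right sc_mult_left sc_mult_right nc.subspace_0[OF subspace_M2]
        nc.subspace_add[OF subspace_M2] nc.subspace_scale[OF subspace_M2])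
  have "a * (x * m * y) \<in> M2 \<and> x * m * y * a \<in> M2" if "m \<in> L2" for x m y
    using sandwich_in_M2[OF that, of "a * x" y] sandwich_in_M2[OF that, of x "y * a"]
    by (simp add: mult.assoc)
  hence "M2 \<subseteq> {k. a * k \<in> M2 \<and> k * a \<in> M2}"
    by (subst (1) M2_def) (rule nc.span_minimal[OF _ sub], auto)
  thus "a * k \<in> M2" "k * a \<in> M2" using assms by auto
qed

lemma ideal_of_mult:
  assumes "k \<in> ideal_of P"
  shows "a * k \<in> ideal_of P" "k * a \<in> ideal_of P"
proof -
  have sub: "nc.subspace {k. a * k \<in> ideal_of P \<and> k * a \<in> ideal_of P}"
    by (intro nc.subspaceI)
      (auto simp: distrib_left distrib_right sc_mult_left sc_mult_right nc.subspace_0[OF subspace_ideal_of]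
        nc.subspace_add[OF subspace_ideal_of] nc.subspace_scale[OF subspace_ideal_of])
  have "a * (x * P * y) \<in> ideal_of P \<and> x * P * y * a \<in> ideal_of P" for x y
    using sandwich_in_ideal_of[of "a * x" P y] sandwich_in_ideal_of[of x P "y * a"]
    by (simp add: mult.assoc)
  hence "ideal_of P \<subseteq> {k. a * k \<in> ideal_of P \<and> k * a \<in> ideal_of P}"
    by (subst (1) ideal_of_def) (rule nc.span_minimal[OF _ sub], auto)
  thus "a * k \<in> ideal_of P" "k * a \<in> ideal_of P" using assms by auto
qed

lemma generator_in_ideal_of: "P \<in> ideal_of P"
  using sandwich_in_ideal_of[of 1 P 1] by simp

text \<open>Pulling the first letter \<open>x\<close> of \<open>u\<close> to the front of
  \<open>v = v1 x v2\<close> costs \<open>[x, v1] v2\<close>, an element of \<open>M2\<close>;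
  induction handles the rest.\<close>

lemma ncmon_perm_diff_in_M2:
  assumes "mset u = mset v"
  shows "ncmon u - ncmon v \<in> M2"
  using assms
proof (induction u arbitrary: v)
  case Nil
  thus ?case by (simp add: nc.subspace_0[OF subspace_M2])
next
  case (Cons x u)
  hence "x \<in> set v" by (metis list.set_intros(1) mset_eq_setD)
  then obtain v1 v2 where v: "v = v1 @ x # v2" by (meson split_list)
  have "ncmon u - ncmon (v1 @ v2) \<in> M2"
    using Cons.prems v by (intro Cons.IH) simp
  hence "ncmon [x] * (ncmon u - ncmon (v1 @ v2)) \<in> M2" by (rule M2_mult)
  moreover have "commutator (ncmon [x]) (ncmon v1) * ncmon v2 \<in> M2"
    by (intro M2_mult subsetD[OF L2_subset_M2] commutator_in_L2)
  ultimately have "ncmon [x] * (ncmon u - ncmon (v1 @ v2)) +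
      commutator (ncmon [x]) (ncmon v1) * ncmon v2 \<in> M2"
    by (rule nc.subspace_add[OF subspace_M2])
  thus ?case
    by (simp add: v ncmon_append ncmon_Cons[of x u] ncmon_Cons[of x v2] commutator_def algebra_simps)
qed

lemma L3_subset_L2: "L3 \<subseteq> L2"
  unfolding L3_def by (intro nc.span_minimal) (auto simp: commutator_in_L2 subspace_L2)

lemma ab_L2: "x \<in> L2 \<Longrightarrow> ab idx x = 0"
proof -
  have "nc.subspace {x. ab idx x = 0}"
    by (intro nc.subspaceI) (auto simp: ab_add ab_sc ab_zero)
  hence "L2 \<subseteq> {x. ab idx x = 0}"
    unfolding L2_def by (intro nc.span_minimal) (auto simp: ab_commutator)
  thus "x \<in> L2 \<Longrightarrow> ab idx x = 0" by auto
qed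

section \<open>Cyclic cocycles\<close>

locale cyclic_cocycle =
  fixes b :: "'n nc_poly \<Rightarrow> 'n nc_poly \<Rightarrow> complex"
  assumes add_left: "b (x + y) z = b x z + b y z"
    and add_right: "b x (y + z) = b x y + b x z"
    and scale_left: "b (sc c x) y = c * b x y"
    and scale_right: "b x (sc c y) = c * b x y"
    and leibniz: "b x (y * z) = b (x * y) z + b (z * x) y"
    and unit_left: "b 1 x = 0"
begin

lemma unit_right: "b x 1 = 0"
  using leibniz[of x 1 1] by simp

lemma anti: "b x y = - b y x"
  using leibniz[of 1 x y] by (simp add: unit_left add_eq_0_iff2)

text \<open>The word \<open>w\<close> is read as a stretch of the cyclic word \<open>w r\<close>,
  with weights \<open>j\<close>, \<open>j + 1\<close>, and so on. A letter already read moves to the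
  end of \<open>r\<close>, so the first argument of \<open>b\<close> is always the rest of the
  cyclic word, starting behind the current letter.\<close>

fun wsum :: "nat \<Rightarrow> 'n list \<Rightarrow> 'n nc_poly \<Rightarrow> complex" where
  "wsum j [] r = 0"
| "wsum j (x # w) r = of_nat j * b (ncmon w * r) (ncmon [x]) + wsum (Suc j) w (r * ncmon [x])"

lemma wsum_append:
  "wsum j (u @ v) r = wsum j u (ncmon v * r) + wsum (j + length u) v (r * ncmon u)"
  by (induction u arbitrary: j r)
    (simp_all add: ncmon_append mult.assoc ncmon_Cons[symmetric])

text \<open>Raising all weights by \<open>i\<close> adds \<open>i\<close> times the unweighted sum,
  and iterating \<open>leibniz\<close> over the letters of \<open>w\<close> identifies that sum with
  \<open>b r (ncmon w)\<close>.\<close>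

lemma wsum_shift: "wsum (i + j) w r = wsum j w r + of_nat i * b r (ncmon w)"
proof (induction w arbitrary: j r)
  case Nil
  show ?case by (simp add: unit_right)
next
  case (Cons x w)
  show ?case
    using Cons.IH[of "Suc j" "r * ncmon [x]"]
    by (simp add: ncmon_Cons[of x w] leibniz algebra_simps)
qed

lemma wsum_add: "wsum j w (r + s) = wsum j w r + wsum j w s"
  by (induction w arbitrary: j r s) (simp_all add: algebra_simps add_left)

lemma wsum_scale: "wsum j w (sc c r) = c * wsum j w r"
  by (induction w arbitrary: j r) (simp_all add: algebra_simps scale_left sc_mult_left sc_mult_right)

text \<open>Every first argument occurring in the sum arises from \<open>r\<close> by
  multiplications on both sides, so it stays in \<open>K\<close>.\<close>

lemma wsum_eq_0:
  assumes "r \<in> K" "\<And>k x. k \<in> K \<Longrightarrow> x * k \<in> K" "\<And>k x. k \<in> K \<Longrightarrow> k * x \<in> K"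
    and "\<And>k x. k \<in> K \<Longrightarrow> b k x = 0"
  shows "wsum j w r = 0"
  using assms(1) by (induction w arbitrary: j r) (simp_all add: assms(2-4))

text \<open>
  On a word \<open>w\<close> of length \<open>m\<close> the potential is \<open>1/m\<close> times the sum over the positions \<open>k < m\<close> of
  \<open>k b(v, x)\<close>, where \<open>v x\<close> is the cyclic rotation of \<open>w\<close> that ends in its \<open>k\<close>-th letter \<open>x\<close>. The
  formula comes from contracting the \<open>2\<close>-form of \<open>w\<close> with the Euler vector field. For \<open>m = 0\<close> both
  numerator and denominator are \<open>0\<close>.
\<close>

definition pot :: "'n nc_poly \<Rightarrow> complex"
  where "pot = lin_ext (\<lambda>w. wsum 0 (letters w) 1 / of_nat (length (letters w)))"

lemma pot_ncmon: "pot (ncmon w) = wsum 0 w 1 / of_nat (length w)"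
  by (simp add: pot_def ncmon_def)

lemma pot_add: "pot (x + y) = pot x + pot y"
  by (simp add: pot_def lin_ext_add)

lemma pot_sc: "pot (sc c x) = c * pot x"
  by (simp add: pot_def lin_ext_map)

lemma pot_diff: "pot (x - y) = pot x - pot y"
  using pot_add[of "x - y" y] by simp

text \<open>\<open>u v\<close> and \<open>v u\<close> are the same cyclic word, but the letters of
  \<open>v\<close> weigh \<open>length u\<close> more in the first and those of \<open>u\<close>
  weigh \<open>length v\<close> more in the second. By \<open>wsum_shift\<close> and
  \<open>anti\<close> the difference is \<open>length u + length v\<close> times
  \<open>b (ncmon u) (ncmon v)\<close>, and \<open>pot\<close> divides by this length.\<close>

lemma pot_commutator: "pot (commutator x y) = b x y"
proof -
  have words: "pot (commutator (ncmon u) (ncmon v)) = b (ncmon u) (ncmon v)" for u v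
  \<comment> \<open>Outside the case of an empty \<open>u\<close>, the total length, which is the
    divisor, is positive.\<close>
  proof (cases "u = []")
    case True
    thus ?thesis by (simp add: commutator_def unit_left pot_def lin_ext_def)
  next
    case False
    have "wsum 0 (u @ v) 1 - wsum 0 (v @ u) 1 =
        of_nat (length u) * b (ncmon u) (ncmon v) - of_nat (length v) * b (ncmon v) (ncmon u)"
      using wsum_shift[of "length u" 0 v "ncmon u"] wsum_shift[of "length v" 0 u "ncmon v"]
      by (simp add: wsum_append)
    also have "\<dots> = of_nat (length u + length v) * b (ncmon u) (ncmon v)"
      by (simp add: anti[of "ncmon v"] algebra_simps)
    finally show ?thesis
      using False
      by (simp add: commutator_def pot_diff pot_ncmon add.commute[of "length v"]
          diff_divide_distrib[symmetric] flip: ncmon_append of_nat_add)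
  qed
  show ?thesis
  proof (rule nc_hom_eqI[where f = "\<lambda>x. pot (commutator x y)" and s = "\<lambda>c. c"])
    fix u
    show "pot (commutator (ncmon u) y) = b (ncmon u) y"
    proof (rule nc_hom_eqI[where f = "\<lambda>y. pot (commutator (ncmon u) y)" and s = "\<lambda>c. c"])
    qed (rule words | simp add: commutator_def pot_diff pot_add pot_sc add_right scale_right
          sc_mult_left sc_mult_right algebra_simps)+
  qed (simp_all add: commutator_def pot_diff pot_add pot_sc add_left scale_left
          sc_mult_left sc_mult_right algebra_simps)
qed

lemma pot_subspace: "nc.subspace {x. pot x = 0}"
  using pot_sc[of 0 0] by (intro nc.subspaceI) (auto simp: pot_add pot_sc)

lemma pot_L3:
  assumes "\<And>k x. k \<in> M2 \<Longrightarrow> b k x = 0" "x \<in> L3"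
  shows "pot x = 0"
proof -
  have "b a y = 0" if "y \<in> L2" for a y
    using assms(1)[of y a] that L2_subset_M2 anti[of a y] by auto
  hence "L3 \<subseteq> {x. pot x = 0}"
    unfolding L3_def by (intro nc.span_minimal pot_subspace) (auto simp: pot_commutator)
  thus ?thesis using assms(2) by auto
qed

text \<open>
  The relation \<open>P\<close> enters only through the fact that its image in the polynomial ring is not a
  zero divisor.
\<close>

lemma pot_relation_multiple:
  assumes "P \<in> homogeneous d" "inj idx" "ab idx P \<noteq> 0" "P * w \<in> L2"
    and "\<And>k x. k \<in> M2 \<Longrightarrow> b k x = 0" "\<And>k x. k \<in> ideal_of P \<Longrightarrow> b k x = 0"
  shows "pot (P * w) = 0"
proof (rule ab_eq_0_imp[where g = "\<lambda>w. pot (P * w)"])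
  show "ab idx w = 0"
    using ab_L2[OF assms(4), of idx] assms(3) by (simp add: ab_mult)
next
  fix u v :: "'n list"
  assume uv: "mset u = mset v"
  \<comment> \<open>All words of \<open>P\<close> have length \<open>d\<close>, so the divisor is
    the same for all of them. The letters of \<open>u\<close> contribute \<open>wsum d u P\<close>,
    whose first arguments are multiples of \<open>P\<close> and hence killed by \<open>b\<close>;
    only the letters of \<open>P\<close> remain.\<close>
  have eq: "pot (P * ncmon u) = (\<Sum>p\<in>Poly_Mapping.keys P. Poly_Mapping.lookup P p *
      wsum 0 (letters p) (ncmon u)) / of_nat (d + length u)" for u
  proof -
    have "pot (P * ncmon u) = (\<Sum>p\<in>Poly_Mapping.keys P. Poly_Mapping.lookup P p *
        pot (ncmon (letters p @ u)))"
      unfolding pot_def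
      by (subst (1) nc_poly_eq_sum_ncmon[of P])
        (simp add: sum_distrib_right lin_ext_sum lin_ext_map sc_mult_left ncmon_append)
    also have "\<dots> = (\<Sum>p\<in>Poly_Mapping.keys P. Poly_Mapping.lookup P p *
        ((wsum 0 (letters p) (ncmon u) + wsum d u (ncmon (letters p))) / of_nat (d + length u)))"
      using assms(1) by (intro sum.cong) (auto simp: homogeneous_def pot_ncmon wsum_append)
    also have "\<dots> = (\<Sum>p\<in>Poly_Mapping.keys P. Poly_Mapping.lookup P p *
        wsum 0 (letters p) (ncmon u)) / of_nat (d + length u) +
        (\<Sum>p\<in>Poly_Mapping.keys P. Poly_Mapping.lookup P p *
        wsum d u (ncmon (letters p))) / of_nat (d + length u)"
      by (simp only: distrib_left add_divide_distrib times_divide_eq_right sum.distrib sum_divide_distrib)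
    also have "(\<Sum>p\<in>Poly_Mapping.keys P. Poly_Mapping.lookup P p * wsum d u (ncmon (letters p))) =
        wsum d u P"
    proof -
      have "wsum d u 0 = 0" using wsum_scale[of d u 0 0] by simp
      hence "wsum d u (sum f A) = (\<Sum>x\<in>A. wsum d u (f x))" for f and A :: "'n free_monoid set"
        by (induction A rule: infinite_finite_induct) (auto simp: wsum_add)
      thus ?thesis
        by (subst (3) nc_poly_eq_sum_ncmon[of P]) (simp add: wsum_scale)
    qed
    also have "wsum d u P = 0"
    proof (rule wsum_eq_0[where K = "ideal_of P"])
      show "P \<in> ideal_of P"
        using generator_in_ideal_of .
    qed (use ideal_of_mult assms(6) in auto)
    finally show ?thesis by simp
  qed
  \<comment> \<open>In what remains, \<open>u\<close> occurs only inside first arguments of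
    \<open>b\<close>, which matter modulo \<open>M2\<close>; there permuted words agree.\<close>
  have "wsum 0 p (ncmon u) = wsum 0 p (ncmon v)" for p
  proof -
    have "wsum 0 p (ncmon u - ncmon v) = 0"
      by (rule wsum_eq_0[OF ncmon_perm_diff_in_M2[OF uv]]) (use M2_mult assms(5) in auto)
    thus ?thesis using wsum_add[of 0 p "ncmon u - ncmon v" "ncmon v"] by simp
  qed
  thus "pot (P * ncmon u) = pot (P * ncmon v)"
    by (simp only: eq mset_eq_length[OF uv])
next
  show "inj idx" by (rule assms(2))
next
  fix x y show "pot (P * (x + y)) = pot (P * x) + pot (P * y)"
    by (simp only: distrib_left pot_add)
next
  fix c x show "pot (P * sc c x) = c * pot (P * x)"
    by (simp only: sc_mult_right pot_sc)
qed

text \<open>Since \<open>u P v = P (v u) + [u, P v]\<close> and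
  \<open>pot [u, P v] = b u (P v) = 0\<close>, an element of the ideal is some \<open>P w\<close> up
  to an element of \<open>L2\<close> killed by \<open>pot\<close>. As \<open>x\<close> and
  \<open>l\<close> lie in \<open>L2\<close>, so does \<open>P w\<close>, and
  \<open>pot_relation_multiple\<close> applies.\<close>

lemma pot_eq_0:
  assumes "P \<in> homogeneous d" "inj idx" "ab idx P \<noteq> 0"
    and M2: "\<And>k x. k \<in> M2 \<Longrightarrow> b k x = 0" and I: "\<And>k x. k \<in> ideal_of P \<Longrightarrow> b k x = 0"
    and "x \<in> L2" "x = l + i" "l \<in> L3" "i \<in> ideal_of P"
  shows "pot x = 0"
proof -
  let ?S = "{P * w + y |w y. y \<in> L2 \<and> pot y = 0}"
  have "nc.subspace ?S"
  proof (intro nc.subspaceI)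
    show "0 \<in> ?S"
      unfolding mem_Collect_eq
      by (rule exI[of _ 0], rule exI[of _ 0])
        (use nc.subspace_0[OF pot_subspace] in \<open>simp add: L2_def nc.span_zero\<close>)
  next
    fix x y assume "x \<in> ?S" "y \<in> ?S"
    then obtain w1 y1 w2 y2 where "x = P * w1 + y1" "y = P * w2 + y2"
        "y1 \<in> L2" "pot y1 = 0" "y2 \<in> L2" "pot y2 = 0" by auto
    thus "x + y \<in> ?S"
      unfolding mem_Collect_eq
      by - (rule exI[where x = "w1 + w2"], rule exI[where x = "y1 + y2"],
        simp add: distrib_left pot_add L2_def nc.span_add)
  next
    fix x c assume "x \<in> ?S"
    then obtain w y where "x = P * w + y" "y \<in> L2" "pot y = 0" by auto
    thus "sc c x \<in> ?S"
      unfolding mem_Collect_eq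
      by - (rule exI[where x = "sc c w"], rule exI[where x = "sc c y"],
        simp add: nc.scale_right_distrib sc_mult_right pot_sc L2_def nc.span_scale)
  qed
  moreover have "u * P * v \<in> ?S" for u v
  proof (intro CollectI exI conjI)
    show "u * P * v = P * (v * u) + commutator u (P * v)"
      by (simp add: commutator_def mult.assoc)
    show "commutator u (P * v) \<in> L2" by (rule commutator_in_L2)
    have "1 * P * v \<in> ideal_of P"
      unfolding ideal_of_def by (rule nc.span_base) blast
    thus "pot (commutator u (P * v)) = 0"
      using I[of "P * v" u] anti[of u "P * v"] by (simp add: pot_commutator)
  qed
  ultimately have "ideal_of P \<subseteq> ?S"
    unfolding ideal_of_def by (intro nc.span_minimal) auto
  then obtain w y where i: "i = P * w + y" "y \<in> L2" "pot y = 0"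
    using assms(9) by auto
  have "l \<in> L2" using assms(8) L3_subset_L2 by auto
  hence "x - l - y \<in> L2" using i assms(6) unfolding L2_def by (intro nc.span_diff)
  hence "P * w \<in> L2" using assms(7) i by simp
  hence "pot (P * w) = 0"
    by (intro pot_relation_multiple[OF assms(1-3)] M2 I)
  thus ?thesis
    using i pot_L3[OF M2 assms(8)] by (simp add: assms(7) pot_add)
qed

end

text \<open>A functional \<open>t\<close> separating \<open>[k, e]\<close> from \<open>L3\<close>
  would be a \<open>lie_trace\<close>. It sends \<open>[a [u, v] b, e]\<close> to
  \<open>Q (b * a) u v e\<close>, which is \<open>0\<close> by \<open>Q_eq_0\<close>, and the
  elements \<open>a [u, v] b\<close> span \<open>M2\<close>.\<close>

lemma commutator_M2_in_L3:
  fixes k :: "'n::finite nc_poly"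
  assumes "CARD('n) \<le> 3" "k \<in> M2"
  shows "commutator k e \<in> L3"
proof (rule ccontr)
  assume "commutator k e \<notin> L3"
  then obtain t where "Vector_Spaces.linear sc (*) t" and t: "\<forall>y\<in>L3. t y = 0"
      "t (commutator k e) \<noteq> 0"
    using nc.subspace_separation[of "L3 :: 'n nc_poly set" "commutator k e"]
    by (auto simp: L3_def)
  interpret t: Vector_Spaces.linear "sc" "(*) :: complex \<Rightarrow> _" t by fact
  interpret lie_trace t
  proof
    fix a b c :: "'n nc_poly"
    have "commutator c (commutator a b) \<in> L3"
      unfolding L3_def by (rule nc.span_base) (use commutator_in_L2 in blast)
    hence "t (commutator c (commutator a b)) = 0" using t by blast
    thus "t (commutator (commutator a b) c) = 0"
      by (simp add: commutator_def t.diff)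
  qed (rule t.add)
  note Q0 = Q_eq_0[OF assms(1) lie_trace_axioms t.scale]
  have "t (commutator (a * m * b) e) = 0" if "m \<in> L2" for a m b
  proof -
    have "L2 \<subseteq> {m. t (commutator (a * m * b) e) = 0}"
      unfolding L2_def
    proof (rule nc.span_minimal)
      show "nc.subspace {m. t (commutator (a * m * b) e) = 0}"
        by (intro nc.subspaceI)
          (auto simp: commutator_def t.diff t.add t.scale algebra_simps sc_mult_left sc_mult_right)
      have "t (commutator (a * commutator u v * b) e) = Q (b * a) u v e" for u v
        using trace[of "a * commutator u v" b e] by (simp add: Q_def mult.assoc)
      thus "{commutator a b |a b. True} \<subseteq> {m. t (commutator (a * m * b) e) = 0}"
        by (auto simp: Q0)
    qed
    thus ?thesis using that by auto
  qed
  hence "M2 \<subseteq> {k. t (commutator k e) = 0}"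
    unfolding M2_def
    by (intro nc.span_minimal nc.subspaceI)
      (auto simp: commutator_def t.diff t.add t.scale algebra_simps sc_mult_left sc_mult_right)
  with assms(2) t(2) show False by auto
qed

section \<open>Complex vector spaces presented as images of linear maps\<close>

lemma complex_ring_carrier [simp]: "carrier complex_ring = UNIV"
  by (simp add: ring_of_type_algebra_def)

text \<open>
  Nothing is assumed about the operations of \<open>M\<close> as such: the vector space axioms are inherited
  from \<open>V\<close>.
\<close>

locale presentation = vector_space scale
  for scale :: "complex \<Rightarrow> 'e \<Rightarrow> 'e::ab_group_add" +
  fixes V :: "'e set" and h :: "'e \<Rightarrow> 'a" and M :: "(complex, 'a, 'm) module_scheme"
  assumes subspace_V: "subspace V"
    and carrier_eq: "carrier M = h ` V"
    and hom_add: "x \<in> V \<Longrightarrow> y \<in> V \<Longrightarrow> h (x + y) = h x \<oplus>\<^bsub>M\<^esub> h y"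
    and hom_zero: "h 0 = \<zero>\<^bsub>M\<^esub>"
    and hom_scale: "x \<in> V \<Longrightarrow> h (scale c x) = c \<odot>\<^bsub>M\<^esub> h x"
begin

lemmas V_closed = subspace_0[OF subspace_V] subspace_add[OF subspace_V]
  subspace_scale[OF subspace_V] subspace_neg[OF subspace_V] subspace_diff[OF subspace_V]

sublocale M: abelian_group M
proof (rule abelian_groupI)
  fix x assume "x \<in> carrier M"
  then obtain u where u: "u \<in> V" "x = h u" by (auto simp: carrier_eq)
  have "h (- u) \<oplus>\<^bsub>M\<^esub> h u = \<zero>\<^bsub>M\<^esub>"
    using u hom_add[of "- u" u] by (simp add: V_closed hom_zero)
  thus "\<exists>y\<in>carrier M. y \<oplus>\<^bsub>M\<^esub> x = \<zero>\<^bsub>M\<^esub>"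
    using u by (auto simp: carrier_eq V_closed)
qed (auto simp: carrier_eq V_closed algebra_simps simp flip: hom_add hom_zero)

lemma hom_closed: "x \<in> V \<Longrightarrow> h x \<in> carrier M"
  by (simp add: carrier_eq)

lemma hom_uminus: "x \<in> V \<Longrightarrow> h (- x) = \<ominus>\<^bsub>M\<^esub> h x"
  using hom_add[of "- x" x]
  by (intro M.minus_equality[symmetric]) (auto simp: hom_closed V_closed hom_zero)

lemma hom_diff: "x \<in> V \<Longrightarrow> y \<in> V \<Longrightarrow> h (x - y) = h x \<ominus>\<^bsub>M\<^esub> h y"
  using hom_add[of x "- y"] by (simp add: a_minus_def hom_uminus V_closed)

lemma hom_eq_iff: "x \<in> V \<Longrightarrow> y \<in> V \<Longrightarrow> h x = h y \<longleftrightarrow> h (x - y) = \<zero>\<^bsub>M\<^esub>"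
  using hom_add[of "x - y" y] M.add.r_cancel_one'[of "h y" "h (x - y)"]
  by (auto simp: V_closed hom_closed)

lemma submodule_image:
  assumes "subspace U" "U \<subseteq> V"
  shows "submodule (h ` U) complex_ring M"
proof (intro submodule.intro subgroup.intro submodule_axioms.intro)
  show "h ` U \<subseteq> carrier (add_monoid M)"
    using assms(2) by (auto simp: carrier_eq)
next
  fix x y assume "x \<in> h ` U" "y \<in> h ` U"
  then obtain u v where "u \<in> U" "v \<in> U" "x = h u" "y = h v" by blast
  moreover from this have "h u \<oplus>\<^bsub>M\<^esub> h v = h (u + v)" "u + v \<in> U"
    using assms by (auto simp: hom_add subset_iff subspace_add)
  ultimately show "x \<otimes>\<^bsub>add_monoid M\<^esub> y \<in> h ` U" by simp
next
  show "\<one>\<^bsub>add_monoid M\<^esub> \<in> h ` U"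
    using subspace_0[OF assms(1)] hom_zero by (metis imageI monoid.select_convs(2))
next
  fix x assume "x \<in> h ` U"
  then obtain u where "u \<in> U" "x = h u" by blast
  moreover from this have "\<ominus>\<^bsub>M\<^esub> h u = h (- u)" "- u \<in> U"
    using assms by (auto simp: hom_uminus subset_iff subspace_neg)
  ultimately show "inv\<^bsub>add_monoid M\<^esub> x \<in> h ` U" by (simp add: a_inv_def)
next
  fix c x assume "x \<in> h ` U"
  then obtain u where "u \<in> U" "x = h u" by blast
  moreover from this have "c \<odot>\<^bsub>M\<^esub> h u = h (scale c u)" "scale c u \<in> U"
    using assms by (auto simp: hom_scale subset_iff subspace_scale)
  ultimately show "c \<odot>\<^bsub>M\<^esub> x \<in> h ` U" by simp
qed

lemma subspace_vimage_subgroup: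
  assumes "subgroup H (add_monoid M)" "\<And>c x. x \<in> V \<Longrightarrow> h x \<in> H \<Longrightarrow> h (scale c x) \<in> H"
  shows "subspace {x \<in> V. h x \<in> H}"
  using subgroup.one_closed[OF assms(1)] subgroup.m_closed[OF assms(1)] assms(2)
  by (intro subspaceI) (auto simp: V_closed hom_zero hom_add)

text \<open>Submodules of \<open>M\<close> pull back to subspaces of \<open>V\<close>, so the
  minimal ones correspond.\<close>

lemma lin_span_image:
  assumes "S \<subseteq> V"
  shows "lin_span complex_ring M (h ` S) = h ` span S"
proof (rule antisym)
  have "span S \<subseteq> V" using assms subspace_V by (rule span_minimal)
  hence "submodule (h ` span S) complex_ring M"
    by (intro submodule_image) auto
  thus "lin_span complex_ring M (h ` S) \<subseteq> h ` span S"
    unfolding lin_span_def using span_superset by blast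
next
  show "h ` span S \<subseteq> lin_span complex_ring M (h ` S)"
    unfolding lin_span_def
  proof (rule Inter_greatest)
    fix H assume "H \<in> {H. submodule H complex_ring M \<and> h ` S \<subseteq> H}"
    hence H: "submodule H complex_ring M" "h ` S \<subseteq> H" by auto
    have "subspace {x \<in> V. h x \<in> H}"
      using submodule.axioms(1)[OF H(1)] submodule.smult_closed[OF H(1)]
      by (intro subspace_vimage_subgroup) (auto simp: hom_scale)
    hence "span S \<subseteq> {x \<in> V. h x \<in> H}"
      using H(2) assms by (intro span_minimal) auto
    thus "h ` span S \<subseteq> H" by auto
  qed
qed

lemma coset_image:
  assumes "U \<subseteq> V" "x \<in> V"
  shows "h ` U +>\<^bsub>M\<^esub> h x = (\<lambda>u. h (u + x)) ` U"
  using assms by (auto simp: a_r_coset_def' hom_add subset_iff)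

lemma coset_eq_iff:
  assumes "subspace U" "U \<subseteq> V" "x \<in> V" "y \<in> V"
  shows "h ` U +>\<^bsub>M\<^esub> h x = h ` U +>\<^bsub>M\<^esub> h y \<longleftrightarrow> h (x - y) \<in> h ` U"
proof
  assume "h ` U +>\<^bsub>M\<^esub> h x = h ` U +>\<^bsub>M\<^esub> h y"
  moreover have "h (0 + x) \<in> h ` U +>\<^bsub>M\<^esub> h x"
    using assms subspace_0[OF assms(1)] unfolding coset_image[OF assms(2,3)] by blast
  ultimately obtain u where u: "u \<in> U" "h x = h (u + y)"
    using assms by (auto simp: coset_image)
  hence "h (x - (u + y)) = \<zero>\<^bsub>M\<^esub>"
    using assms by (subst (asm) hom_eq_iff) (auto simp: V_closed subset_iff)
  hence "h (x - y) = h u"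
    using assms u by (subst hom_eq_iff) (auto simp: V_closed subset_iff algebra_simps)
  thus "h (x - y) \<in> h ` U" using u by auto
next
  assume "h (x - y) \<in> h ` U"
  then obtain u where u: "u \<in> U" "h (x - y) = h u" by auto
  hence "h (x - y - u) = \<zero>\<^bsub>M\<^esub>"
    using assms by (subst (asm) hom_eq_iff) (auto simp: V_closed subset_iff)
  hence eq: "h (v + x) = h (v + u + y)" if "v \<in> U" for v
    using assms u that by (subst hom_eq_iff) (auto simp: V_closed subset_iff algebra_simps)
  have "(\<lambda>v. h (v + x)) ` U = (\<lambda>v. h (v + y)) ` (\<lambda>v. v + u) ` U"
    using eq by (auto simp: image_image)
  also have "(\<lambda>v. v + u) ` U = U"
  proof (intro equalityI subsetI)
    fix v assume "v \<in> U"
    hence "v - u \<in> U" using u assms(1) by (simp add: subspace_diff)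
    thus "v \<in> (\<lambda>v. v + u) ` U" by (metis diff_add_cancel imageI)
  qed (use u subspace_add[OF assms(1)] in auto)
  finally show "h ` U +>\<^bsub>M\<^esub> h x = h ` U +>\<^bsub>M\<^esub> h y"
    using assms by (simp add: coset_image)
qed

lemma coset_add:
  assumes "subspace U" "U \<subseteq> V" "x \<in> V" "y \<in> V"
  shows "(h ` U +>\<^bsub>M\<^esub> h x) <+>\<^bsub>M\<^esub> (h ` U +>\<^bsub>M\<^esub> h y) = h ` U +>\<^bsub>M\<^esub> h (x + y)"
proof -
  have eq: "h (u + x) \<oplus>\<^bsub>M\<^esub> h (v + y) = h (u + v + (x + y))" if "u \<in> U" "v \<in> U" for u v
    using that assms by (subst hom_add[symmetric]) (auto simp: V_closed algebra_simps subset_iff)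
  have "(h ` U +>\<^bsub>M\<^esub> h x) <+>\<^bsub>M\<^esub> (h ` U +>\<^bsub>M\<^esub> h y) =
      (\<Union>u\<in>U. \<Union>v\<in>U. {h (u + x) \<oplus>\<^bsub>M\<^esub> h (v + y)})"
    by (simp add: set_add_def' coset_image assms)
  also have "\<dots> = (\<Union>u\<in>U. \<Union>v\<in>U. {h (u + v + (x + y))})"
    by (intro SUP_cong refl) (simp only: eq)
  also have "\<dots> = (\<lambda>w. h (w + (x + y))) ` U"
  proof (intro equalityI subsetI)
    fix z assume "z \<in> (\<lambda>w. h (w + (x + y))) ` U"
    then obtain w where "w \<in> U" "z = h (w + 0 + (x + y))" by auto
    thus "z \<in> (\<Union>u\<in>U. \<Union>v\<in>U. {h (u + v + (x + y))})"
      using subspace_0[OF assms(1)] by blast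
  qed (use subspace_add[OF assms(1)] in blast)
  finally show ?thesis
    using assms by (simp add: coset_image V_closed)
qed

lemma coset_absorb:
  assumes "subspace U" "U \<subseteq> V" "x \<in> V" "u \<in> U"
  shows "h ` U +>\<^bsub>M\<^esub> h (u + x) = h ` U +>\<^bsub>M\<^esub> h x"
  using assms by (subst coset_eq_iff) (auto simp: V_closed subset_iff)

lemma presentation_subspace:
  assumes "subspace U" "U \<subseteq> V"
  shows "presentation scale U h (M\<lparr>carrier := h ` U\<rparr>)"
  using assms by unfold_locales (auto simp: hom_add hom_zero hom_scale subset_iff)

text \<open>Changes the presenting space; it serves to present \<open>B\<^sub>2(A)\<close> by
  symbols, as is done for \<open>\<Omega>\<^sup>1/d\<Omega>\<^sup>0\<close>, instead of by
  \<open>L2\<close>.\<close>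

lemma presentation_comp:
  assumes "vector_space s" "module.subspace s W"
    and "\<And>x y. x \<in> W \<Longrightarrow> y \<in> W \<Longrightarrow> f (x + y) = f x + f y"
    and "\<And>c x. x \<in> W \<Longrightarrow> f (s c x) = scale c (f x)"
    and "f ` W \<subseteq> V" "h ` V \<subseteq> (\<lambda>x. h (f x)) ` W"
  shows "presentation s W (\<lambda>x. h (f x)) M"
proof -
  interpret W: vector_space s by fact
  have "f 0 = 0"
    using assms(3)[of 0 0] W.subspace_0[OF assms(2)] by simp
  thus ?thesis
    using assms by unfold_locales (auto simp: hom_add hom_zero hom_scale carrier_eq image_subset_iff)
qed

end

section \<open>Quotients and isomorphisms of presented spaces\<close>

lemma quot_simps:
  "carrier (quot M W) = (\<lambda>x. W +>\<^bsub>M\<^esub> x) ` carrier M"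
  "\<zero>\<^bsub>quot M W\<^esub> = W"
  "\<one>\<^bsub>quot M W\<^esub> = W +>\<^bsub>M\<^esub> \<one>\<^bsub>M\<^esub>"
  "add (quot M W) = set_add M"
  "monoid.mult (quot M W) = rcoset_mult M W"
  "c \<odot>\<^bsub>quot M W\<^esub> U = (\<Union>x\<in>U. W +>\<^bsub>M\<^esub> (c \<odot>\<^bsub>M\<^esub> x))"
  by (auto simp: quot_def ring.defs module.defs FactRing_def A_RCOSETS_def' ring.extend_def)

text \<open>The presenting space is kept, so every iterated quotient is controlled by subspaces of
  the same \<open>V\<close>.\<close>

lemma presentation_quot:
  fixes M :: "(complex, 'a) module"
  assumes "presentation scale V h M" "module.subspace scale U" "U \<subseteq> V"
  shows "presentation scale V (\<lambda>x. h ` U +>\<^bsub>M\<^esub> h x) (quot M (h ` U))"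
proof -
  interpret presentation scale V h M by fact
  note U = assms(2,3)
  show ?thesis
  proof
    fix x y assume "x \<in> V" "y \<in> V"
    thus "h ` U +>\<^bsub>M\<^esub> h (x + y) = (h ` U +>\<^bsub>M\<^esub> h x) \<oplus>\<^bsub>quot M (h ` U)\<^esub> (h ` U +>\<^bsub>M\<^esub> h y)"
      using U by (simp add: quot_simps coset_add)
  next
    have "h ` U +>\<^bsub>M\<^esub> h 0 = h ` U"
      using U by (subst coset_image) (auto simp: V_closed)
    thus "h ` U +>\<^bsub>M\<^esub> h 0 = \<zero>\<^bsub>quot M (h ` U)\<^esub>"
      by (simp add: quot_simps)
  next
    fix c x assume x: "x \<in> V"
    have "h ` U +>\<^bsub>M\<^esub> (c \<odot>\<^bsub>M\<^esub> h (u + x)) = h ` U +>\<^bsub>M\<^esub> h (scale c x)" if "u \<in> U" for u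
    proof -
      have "h ` U +>\<^bsub>M\<^esub> (c \<odot>\<^bsub>M\<^esub> h (u + x)) = h ` U +>\<^bsub>M\<^esub> h (scale c u + scale c x)"
        using that x U by (simp add: V_closed subset_iff scale_right_distrib flip: hom_scale)
      also have "\<dots> = h ` U +>\<^bsub>M\<^esub> h (scale c x)"
        using that x U by (intro coset_absorb) (auto simp: V_closed subspace_scale)
      finally show ?thesis .
    qed
    \<comment> \<open>The scalar action on cosets is a union over the coset; a constant union equals
      its common value when the index set is nonempty.\<close>
    moreover have "U \<noteq> {}" using subspace_0[OF U(1)] by auto
    ultimately show "h ` U +>\<^bsub>M\<^esub> h (scale c x) = c \<odot>\<^bsub>quot M (h ` U)\<^esub> (h ` U +>\<^bsub>M\<^esub> h x)"
      using x U by (simp add: quot_simps coset_image[of U x])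
  qed (auto simp: quot_simps carrier_eq V_closed subspace_V)
qed

text \<open>Maps out of one space with the same kernel have isomorphic images:
  \<open>h x \<mapsto> h' x\<close> is well defined and injective. It respects the gradings because
  both come from the same sets \<open>E k\<close>.\<close>

lemma graded_iso_presentations:
  assumes "presentation scale V h M" "presentation scale V h' N"
    and "\<And>x. x \<in> V \<Longrightarrow> h x = \<zero>\<^bsub>M\<^esub> \<longleftrightarrow> h' x = \<zero>\<^bsub>N\<^esub>"
    and "\<And>k. E k \<subseteq> V" "\<And>k. G k = h ` E k" "\<And>k. H k = h' ` E k"
  shows "\<exists>\<phi>. graded_iso M G N H \<phi>"
proof -
  interpret M: presentation scale V h M by fact
  interpret N: presentation scale V h' N by fact
  have eq_iff: "h x = h y \<longleftrightarrow> h' x = h' y" if "x \<in> V" "y \<in> V" for x y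
    using that by (simp add: M.hom_eq_iff N.hom_eq_iff M.V_closed assms(3))
  define \<phi> where "\<phi> m = h' (SOME x. x \<in> V \<and> h x = m)" for m
  have \<phi>: "\<phi> (h x) = h' x" if "x \<in> V" for x
  proof -
    have "(SOME y. y \<in> V \<and> h y = h x) \<in> V \<and> h (SOME y. y \<in> V \<and> h y = h x) = h x"
      by (rule someI[of _ x]) (use that in auto)
    thus ?thesis using that unfolding \<phi>_def by (subst eq_iff[symmetric]) auto
  qed
  have "inj_on \<phi> (carrier M)"
    by (auto intro!: inj_onI simp: M.carrier_eq \<phi> eq_iff)
  moreover have "\<phi> ` h ` U = h' ` U" if "U \<subseteq> V" for U
    using that \<phi> by (force simp: image_image)
  ultimately have "graded_iso M G N H \<phi>"
    unfolding graded_iso_def bij_betw_def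
    using assms(4-6)
    by (auto simp: M.carrier_eq N.carrier_eq \<phi> M.V_closed simp flip: M.hom_add N.hom_add M.hom_scale N.hom_scale)
  thus ?thesis by - (rule HOL.exI[of _ \<phi>])
qed

section \<open>Quotients of the free algebra\<close>

locale nc_quotient = presentation sc UNIV h A
  for h :: "'n nc_poly \<Rightarrow> 'a" and A :: "(complex, 'a) module" +
  assumes hom_mult: "h (x * y) = h x \<otimes>\<^bsub>A\<^esub> h y"
    and hom_one: "h 1 = \<one>\<^bsub>A\<^esub>"
begin

lemma hom_commutator: "h (commutator b c) = h b \<otimes>\<^bsub>A\<^esub> h c \<ominus>\<^bsub>A\<^esub> h c \<otimes>\<^bsub>A\<^esub> h b"
  by (simp add: commutator_def hom_diff hom_mult)

lemma bracket_image: "bracket A (h ` B) (h ` C) = h ` nc.span {commutator b c |b c. b \<in> B \<and> c \<in> C}"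
proof -
  have "{b \<otimes>\<^bsub>A\<^esub> c \<ominus>\<^bsub>A\<^esub> c \<otimes>\<^bsub>A\<^esub> b |b c. b \<in> h ` B \<and> c \<in> h ` C} =
      h ` {commutator b c |b c. b \<in> B \<and> c \<in> C}"
  proof (intro equalityI subsetI)
    fix z assume "z \<in> {b \<otimes>\<^bsub>A\<^esub> c \<ominus>\<^bsub>A\<^esub> c \<otimes>\<^bsub>A\<^esub> b |b c. b \<in> h ` B \<and> c \<in> h ` C}"
    then obtain b c where "b \<in> B" "c \<in> C" "z = h (commutator b c)"
      unfolding hom_commutator by blast
    thus "z \<in> h ` {commutator b c |b c. b \<in> B \<and> c \<in> C}" by blast
  next
    fix z assume "z \<in> h ` {commutator b c |b c. b \<in> B \<and> c \<in> C}"
    then obtain b c where "b \<in> B" "c \<in> C" "z = h (commutator b c)" by blast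
    thus "z \<in> {b \<otimes>\<^bsub>A\<^esub> c \<ominus>\<^bsub>A\<^esub> c \<otimes>\<^bsub>A\<^esub> b |b c. b \<in> h ` B \<and> c \<in> h ` C}"
      unfolding hom_commutator by blast
  qed
  thus ?thesis
    by (simp add: bracket_def lin_span_image)
qed

lemma lcs_2: "lcs A 2 = h ` L2"
  by (simp add: numeral_2_eq_2 carrier_eq bracket_image L2_def)

lemma lcs_3: "lcs A 3 = h ` L3"
  using lcs_2 by (simp add: numeral_2_eq_2 numeral_3_eq_3 carrier_eq bracket_image L3_def)

lemma commutator_ideal: "commutator_ideal A = h ` M2"
proof -
  have "bracket A (carrier A) (carrier A) = h ` L2"
    by (simp add: carrier_eq bracket_image L2_def)
  hence "{a \<otimes>\<^bsub>A\<^esub> m \<otimes>\<^bsub>A\<^esub> b |a m b. a \<in> carrier A \<and> m \<in> bracket A (carrier A) (carrier A) \<and> b \<in> carrier A}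
      = {h a \<otimes>\<^bsub>A\<^esub> h m \<otimes>\<^bsub>A\<^esub> h b |a m b. m \<in> L2}"
    by (force simp: carrier_eq)
  also have "\<dots> = h ` {a * m * b |a m b. m \<in> L2}"
    unfolding hom_mult[symmetric] by blast
  finally have "{a \<otimes>\<^bsub>A\<^esub> m \<otimes>\<^bsub>A\<^esub> b |a m b. a \<in> carrier A \<and> m \<in> bracket A (carrier A) (carrier A) \<and> b \<in> carrier A}
      = h ` {a * m * b |a m b. m \<in> L2}" .
  thus ?thesis
    by (simp add: commutator_ideal_def lin_span_image M2_def)
qed

end

lemma nc_quotient_quot:
  assumes "nc_quotient h A" "nc.subspace U"
    and "\<And>a u. u \<in> U \<Longrightarrow> a * u \<in> U" "\<And>a u. u \<in> U \<Longrightarrow> u * a \<in> U"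
  shows "nc_quotient (\<lambda>x. h ` U +>\<^bsub>A\<^esub> h x) (quot A (h ` U))"
proof -
  interpret nc_quotient h A by fact
  have "presentation sc UNIV (\<lambda>x. h ` U +>\<^bsub>A\<^esub> h x) (quot A (h ` U))"
    using presentation_axioms assms(2) by (rule presentation_quot) simp
  then interpret q: presentation sc UNIV "\<lambda>x. h ` U +>\<^bsub>A\<^esub> h x" "quot A (h ` U)" .
  show ?thesis
  proof
    fix x y
    have "h ` U +>\<^bsub>A\<^esub> (h (u + x) \<otimes>\<^bsub>A\<^esub> h (v + y)) = h ` U +>\<^bsub>A\<^esub> h (x * y)" if "u \<in> U" "v \<in> U" for u v
    proof -
      have "h (u + x) \<otimes>\<^bsub>A\<^esub> h (v + y) = h ((u * v + u * y + x * v) + x * y)"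
        by (simp add: algebra_simps flip: hom_mult)
      moreover have "u * v + u * y + x * v \<in> U"
        using that assms by (intro nc.subspace_add) auto
      ultimately show ?thesis
        using assms(2) by (simp only: coset_absorb subset_UNIV UNIV_I)
    qed
    moreover have "U \<noteq> {}" using nc.subspace_0[OF assms(2)] by auto
    ultimately show "h ` U +>\<^bsub>A\<^esub> h (x * y) = (h ` U +>\<^bsub>A\<^esub> h x) \<otimes>\<^bsub>quot A (h ` U)\<^esub> (h ` U +>\<^bsub>A\<^esub> h y)"
      by (simp add: quot_simps rcoset_mult_def coset_image[of U x] coset_image[of U y])
  qed (simp add: quot_simps hom_one)
qed

section \<open>The free algebra and its relation ideal\<close>

lemma free_algebra_simps:
  "carrier free_algebra = UNIV" "\<zero>\<^bsub>free_algebra\<^esub> = 0" "\<one>\<^bsub>free_algebra\<^esub> = 1"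
  "x \<oplus>\<^bsub>free_algebra\<^esub> y = x + y" "x \<otimes>\<^bsub>free_algebra\<^esub> y = x * y"
  "c \<odot>\<^bsub>free_algebra\<^esub> x = sc c x"
  by (simp_all add: free_algebra_def ring.defs module.defs ring.extend_def ring_of_type_algebra_def)

global_interpretation free: nc_quotient "\<lambda>x. x" "free_algebra :: (complex, 'n nc_poly) module"
  by unfold_locales (simp_all add: free_algebra_simps)

lemma ring_free_algebra: "ring (free_algebra :: (complex, 'n nc_poly) module)"
  by (intro ringI free.M.abelian_group_axioms monoidI)
    (simp_all add: free_algebra_simps algebra_simps)

text \<open>Ideals of the ring are automatically subspaces, because scaling by \<open>c\<close> is
  multiplication by the constant \<open>Poly_Mapping.single 0 c\<close>.\<close>

lemma genideal_free_algebra: "genideal free_algebra {P} = ideal_of P"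
proof (rule antisym)
  have "ideal (ideal_of P) free_algebra"
    using submodule.axioms(1)[OF free.submodule_image[OF subspace_ideal_of[of P]]] ideal_of_mult
    by (intro idealI ring_free_algebra) (auto simp: free_algebra_simps)
  thus "genideal free_algebra {P} \<subseteq> ideal_of P"
    by (intro ring.genideal_minimal[OF ring_free_algebra]) (auto simp: generator_in_ideal_of)
next
  have ideal: "ideal (genideal free_algebra {P}) free_algebra"
    by (intro ring.genideal_ideal[OF ring_free_algebra]) (simp add: free_algebra_simps)
  then interpret ideal "genideal free_algebra {P}" "free_algebra :: (complex, 'a nc_poly) module" .
  have P: "P \<in> genideal free_algebra {P}"
    by (intro ring.genideal_self'[OF ring_free_algebra]) (simp add: free_algebra_simps)
  have "nc.subspace (genideal free_algebra {P})"
    using a_subgroup additive_subgroup.zero_closed[OF additive_subgroup_axioms]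
      additive_subgroup.a_closed[OF additive_subgroup_axioms] I_l_closed
    by (intro nc.subspaceI) (auto simp: free_algebra_simps sc_conv_mult)
  moreover have "u * P * v \<in> genideal free_algebra {P}" for u v
    using I_l_closed[OF P, of u] I_r_closed by (auto simp: free_algebra_simps)
  ultimately show "ideal_of P \<subseteq> genideal free_algebra {P}"
    unfolding ideal_of_def by (intro nc.span_minimal) auto
qed

section \<open>Kaehler differentials of a commutative quotient\<close>

text \<open>
  \<open>'a \<Rightarrow>\<^sub>0 'n nc_poly\<close> maps onto the free module of symbols over the quotient \<open>R\<close> of the free
  algebra, \<open>Poly_Mapping.single f a\<close> being sent to (the image of) \<open>a df\<close>.
\<close>

abbreviation (input) lmul :: "'n nc_poly \<Rightarrow> ('a \<Rightarrow>\<^sub>0 'n nc_poly) \<Rightarrow> 'a \<Rightarrow>\<^sub>0 'n nc_poly"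
  where "lmul a u \<equiv> Poly_Mapping.map ((*) a) u"

global_interpretation symb: vector_space
  "\<lambda>c. Poly_Mapping.map ((*) (Poly_Mapping.single 0 c)) :: ('a \<Rightarrow>\<^sub>0 'n nc_poly) \<Rightarrow> _"
  by unfold_locales
    (auto intro!: poly_mapping_eqI simp: lookup_map_times lookup_add algebra_simps single_add
      mult_single mult.assoc[symmetric])

lemma lmul_add: "lmul a (u + v) = lmul a u + lmul a v"
  by (intro poly_mapping_eqI) (simp add: lookup_map_times lookup_add algebra_simps)

lemma lmul_diff: "lmul a (u - v) = lmul a u - lmul a v"
  by (intro poly_mapping_eqI) (simp add: lookup_map_times lookup_minus algebra_simps)

lemma lmul_zero: "lmul a 0 = 0"
  by (intro poly_mapping_eqI) (simp add: lookup_map_times)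

lemma lmul_lmul: "lmul a (lmul b u) = lmul (a * b) u"
  by (intro poly_mapping_eqI) (simp add: lookup_map_times algebra_simps)

lemma lmul_one: "lmul 1 u = u"
  by (intro poly_mapping_eqI) (simp add: lookup_map_times)

lemma lmul_single: "lmul a (Poly_Mapping.single f b) = Poly_Mapping.single f (a * b)"
  by (intro poly_mapping_eqI) (simp add: lookup_map_times lookup_single when_def)

lemma lmul_scalar: "lmul a (lmul (Poly_Mapping.single 0 c) u) = lmul (Poly_Mapping.single 0 c) (lmul a u)"
  by (simp add: lmul_lmul scalar_central)

locale nc_comm_quotient = nc_quotient h R
  for h :: "'n nc_poly \<Rightarrow> 'a" and R :: "(complex, 'a) module" +
  assumes comm: "h (x * y) = h (y * x)"
begin

definition symbols :: "('a \<Rightarrow>\<^sub>0 'n nc_poly) set"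
  where "symbols = {u. Poly_Mapping.keys u \<subseteq> carrier R}"

definition sym_hom :: "('a \<Rightarrow>\<^sub>0 'n nc_poly) \<Rightarrow> 'a \<Rightarrow> 'a"
  where "sym_hom u = (\<lambda>f. h (Poly_Mapping.lookup u f))"

text \<open>The symbol module with scalars restricted to the complex numbers, which brings it under
  \<open>presentation\<close>. \<open>Omega1_space\<close> restricts scalars only after the
  quotient; \<open>Omega1_space_eq\<close> shows that both orders agree.\<close>

definition sym_space :: "(complex, 'a \<Rightarrow> 'a) module"
  where "sym_space = ring.extend (ring.truncate (symbol_module R))
    (module.fields (\<lambda>c u. (c \<odot>\<^bsub>R\<^esub> \<one>\<^bsub>R\<^esub>) \<odot>\<^bsub>symbol_module R\<^esub> u))"

lemma symbols_iff: "u \<in> symbols \<longleftrightarrow> (\<forall>f. f \<notin> carrier R \<longrightarrow> Poly_Mapping.lookup u f = 0)"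
  by (auto simp: symbols_def in_keys_iff)

lemma single_in_symbols: "Poly_Mapping.single (h x) a \<in> symbols"
  by (simp add: symbols_def carrier_eq)

lemma subspace_symbols: "symb.subspace symbols"
  by (intro symb.subspaceI) (auto simp: symbols_iff lookup_add lookup_map_times)

lemma lmul_in_symbols: "u \<in> symbols \<Longrightarrow> lmul a u \<in> symbols"
  by (simp add: symbols_iff lookup_map_times)

lemma sym_space_simps:
  "carrier sym_space = carrier (symbol_module R)"
  "\<zero>\<^bsub>sym_space\<^esub> = \<zero>\<^bsub>symbol_module R\<^esub>"
  "x \<oplus>\<^bsub>sym_space\<^esub> y = x \<oplus>\<^bsub>symbol_module R\<^esub> y"
  "c \<odot>\<^bsub>sym_space\<^esub> u = (c \<odot>\<^bsub>R\<^esub> \<one>\<^bsub>R\<^esub>) \<odot>\<^bsub>symbol_module R\<^esub> u"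
  by (simp_all add: sym_space_def ring.defs module.defs)

lemma a_inv_sym_space: "\<ominus>\<^bsub>sym_space\<^esub> x = \<ominus>\<^bsub>symbol_module R\<^esub> x"
  by (simp add: a_inv_def m_inv_def sym_space_simps)

lemma subgroup_sym_space:
  "subgroup H (add_monoid sym_space) \<longleftrightarrow> subgroup H (add_monoid (symbol_module R))"
  using a_inv_sym_space by (simp add: subgroup_def sym_space_simps a_inv_def)

lemma sym_hom_lmul: "sym_hom (lmul a u) = h a \<odot>\<^bsub>symbol_module R\<^esub> sym_hom u"
  by (simp add: sym_hom_def symbol_module_def lookup_map_times hom_mult)

sublocale sym: presentation "\<lambda>c. Poly_Mapping.map ((*) (Poly_Mapping.single 0 c))" symbols sym_hom sym_space
proof
  show "carrier sym_space = sym_hom ` symbols"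
  proof (intro equalityI subsetI)
    fix u assume "u \<in> carrier sym_space"
    hence u: "u f \<in> carrier R" "f \<notin> carrier R \<Longrightarrow> u f = \<zero>\<^bsub>R\<^esub>" "finite {f. u f \<noteq> \<zero>\<^bsub>R\<^esub>}" for f
      by (auto simp: sym_space_simps symbol_module_def)
    \<comment> \<open>A coefficientwise lift to the free algebra. Zero is lifted to \<open>0\<close>
      explicitly, since otherwise the support could become infinite.\<close>
    define w where "w f = (if u f = \<zero>\<^bsub>R\<^esub> then 0 else inv_into UNIV h (u f))" for f
    have "{f. w f \<noteq> 0} \<subseteq> {f. u f \<noteq> \<zero>\<^bsub>R\<^esub>}" by (auto simp: w_def)
    hence w: "Poly_Mapping.lookup (Abs_poly_mapping w) = w"
      using u(3) finite_subset by (intro lookup_Abs_poly_mapping) blast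
    have "h (inv_into UNIV h (u f)) = u f" for f
      using u(1)[of f] by (intro f_inv_into_f) (simp add: carrier_eq)
    hence "sym_hom (Abs_poly_mapping w) = u"
      by (auto simp: sym_hom_def w w_def hom_zero)
    moreover have "Abs_poly_mapping w \<in> symbols"
      by (simp add: symbols_iff w) (simp add: w_def u(2))
    ultimately show "u \<in> sym_hom ` symbols" by blast
  next
    fix v assume "v \<in> sym_hom ` symbols"
    then obtain u where u: "u \<in> symbols" "v = sym_hom u" by blast
    have "{f. v f \<noteq> \<zero>\<^bsub>R\<^esub>} \<subseteq> Poly_Mapping.keys u"
      by (auto simp: u(2) sym_hom_def in_keys_iff hom_zero)
    hence "finite {f. v f \<noteq> \<zero>\<^bsub>R\<^esub>}" by (rule finite_subset) simp
    thus "v \<in> carrier sym_space"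
      using u(1) by (simp add: sym_space_simps symbol_module_def u(2) sym_hom_def hom_closed symbols_iff hom_zero)
  qed
next
  fix c u
  have "h (Poly_Mapping.single 0 c) = c \<odot>\<^bsub>R\<^esub> \<one>\<^bsub>R\<^esub>"
    using hom_scale[of 1 c] by (simp add: hom_one sc_conv_mult)
  thus "sym_hom (lmul (Poly_Mapping.single 0 c) u) = c \<odot>\<^bsub>sym_space\<^esub> sym_hom u"
    by (simp add: sym_hom_lmul sym_space_simps)
qed (simp_all add: subspace_symbols sym_space_simps, 
     simp_all add: sym_hom_def symbol_module_def lookup_add hom_add hom_zero)

lemma sym_hom_single: "sym_hom (Poly_Mapping.single f a) = symb R (h a) f"
  by (auto simp: sym_hom_def symb_def lookup_single when_def hom_zero fun_eq_iff)

lemma submodule_sym_image: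
  assumes "symb.subspace U" "U \<subseteq> symbols" "\<And>a u. u \<in> U \<Longrightarrow> lmul a u \<in> U"
  shows "submodule (sym_hom ` U) R (symbol_module R)"
proof (intro submodule.intro submodule_axioms.intro)
  show "subgroup (sym_hom ` U) (add_monoid (symbol_module R))"
    using submodule.axioms(1)[OF sym.submodule_image[OF assms(1,2)]]
    by (simp add: subgroup_sym_space)
  fix r x assume "r \<in> carrier R" "x \<in> sym_hom ` U"
  thus "r \<odot>\<^bsub>symbol_module R\<^esub> x \<in> sym_hom ` U"
    using assms(3) by (auto simp: carrier_eq simp flip: sym_hom_lmul)
qed

lemma sym_hom_minus:
  assumes "u \<in> symbols" "v \<in> symbols"
  shows "sym_hom (u - v) = sym_hom u \<ominus>\<^bsub>symbol_module R\<^esub> sym_hom v"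
  using sym.hom_diff[OF assms]
  by (simp add: a_minus_def a_inv_sym_space sym_space_simps)

lemma sym_rel_gen:
  "sym_hom (Poly_Mapping.single (h x) a - (Poly_Mapping.single (h y) b + Poly_Mapping.single (h z) c)) =
    sym_hom (Poly_Mapping.single (h x) a) \<ominus>\<^bsub>symbol_module R\<^esub>
      (sym_hom (Poly_Mapping.single (h y) b) \<oplus>\<^bsub>symbol_module R\<^esub> sym_hom (Poly_Mapping.single (h z) c))"
  using sym.hom_add[OF single_in_symbols single_in_symbols, of y b z c]
  by (simp add: sym_hom_minus sym.V_closed single_in_symbols sym_space_simps)

section \<open>Kaehler relations lifted to coefficients in the free algebra\<close>

definition rel_gens :: "('a \<Rightarrow>\<^sub>0 'n nc_poly) set"
  where "rel_gens =
    {Poly_Mapping.single (h (x * y)) 1 - (Poly_Mapping.single (h y) x + Poly_Mapping.single (h x) y) |x y. True} \<union>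
    {Poly_Mapping.single (h (sc \<alpha> x + sc \<beta> y)) 1 -
      (Poly_Mapping.single (h x) (sc \<alpha> 1) + Poly_Mapping.single (h y) (sc \<beta> 1)) |\<alpha> \<beta> x y. True}"

lemma rel_gens_subset: "rel_gens \<subseteq> symbols"
  by (auto simp: rel_gens_def intro!: sym.V_closed single_in_symbols)

lemma kaehler_relations_eq: "kaehler_relations R = lin_span R (symbol_module R) (sym_hom ` rel_gens)"
proof -
  have 1: "sym_hom (Poly_Mapping.single (h (x * y)) 1 - (Poly_Mapping.single (h y) x + Poly_Mapping.single (h x) y)) =
      symb R \<one>\<^bsub>R\<^esub> (h x \<otimes>\<^bsub>R\<^esub> h y) \<ominus>\<^bsub>symbol_module R\<^esub>
        (symb R (h x) (h y) \<oplus>\<^bsub>symbol_module R\<^esub> symb R (h y) (h x))" for x y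
    by (simp only: sym_rel_gen) (simp only: sym_hom_single hom_one hom_mult)
  have 2: "sym_hom (Poly_Mapping.single (h (sc \<alpha> x + sc \<beta> y)) 1 -
      (Poly_Mapping.single (h x) (sc \<alpha> 1) + Poly_Mapping.single (h y) (sc \<beta> 1))) =
      symb R \<one>\<^bsub>R\<^esub> (\<alpha> \<odot>\<^bsub>R\<^esub> h x \<oplus>\<^bsub>R\<^esub> \<beta> \<odot>\<^bsub>R\<^esub> h y) \<ominus>\<^bsub>symbol_module R\<^esub>
        (symb R (\<alpha> \<odot>\<^bsub>R\<^esub> \<one>\<^bsub>R\<^esub>) (h x) \<oplus>\<^bsub>symbol_module R\<^esub> symb R (\<beta> \<odot>\<^bsub>R\<^esub> \<one>\<^bsub>R\<^esub>) (h y))" for \<alpha> \<beta> x y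
    by (simp only: sym_rel_gen) (simp only: sym_hom_single hom_one hom_add hom_scale UNIV_I)
  have eq1: "{symb R \<one>\<^bsub>R\<^esub> (f \<otimes>\<^bsub>R\<^esub> g) \<ominus>\<^bsub>symbol_module R\<^esub> (symb R f g \<oplus>\<^bsub>symbol_module R\<^esub> symb R g f) | f g.
        f \<in> carrier R \<and> g \<in> carrier R} =
      sym_hom ` {Poly_Mapping.single (h (x * y)) 1 - (Poly_Mapping.single (h y) x + Poly_Mapping.single (h x) y) |x y. True}"
    (is "?L = sym_hom ` ?S")
  proof (intro equalityI subsetI)
    fix z assume "z \<in> ?L"
    then obtain x y where "z = sym_hom (Poly_Mapping.single (h (x * y)) 1 - (Poly_Mapping.single (h y) x + Poly_Mapping.single (h x) y))"
      unfolding 1 carrier_eq by blast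
    thus "z \<in> sym_hom ` ?S" by blast
  next
    fix z assume "z \<in> sym_hom ` ?S"
    then obtain x y where "z = sym_hom (Poly_Mapping.single (h (x * y)) 1 - (Poly_Mapping.single (h y) x + Poly_Mapping.single (h x) y))"
      by blast
    thus "z \<in> ?L" unfolding 1 carrier_eq by blast
  qed
  have eq2: "{symb R \<one>\<^bsub>R\<^esub> (\<alpha> \<odot>\<^bsub>R\<^esub> f \<oplus>\<^bsub>R\<^esub> \<beta> \<odot>\<^bsub>R\<^esub> g) \<ominus>\<^bsub>symbol_module R\<^esub>
        (symb R (\<alpha> \<odot>\<^bsub>R\<^esub> \<one>\<^bsub>R\<^esub>) f \<oplus>\<^bsub>symbol_module R\<^esub> symb R (\<beta> \<odot>\<^bsub>R\<^esub> \<one>\<^bsub>R\<^esub>) g) | \<alpha> \<beta> f g.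
        f \<in> carrier R \<and> g \<in> carrier R} =
      sym_hom ` {Poly_Mapping.single (h (sc \<alpha> x + sc \<beta> y)) 1 -
        (Poly_Mapping.single (h x) (sc \<alpha> 1) + Poly_Mapping.single (h y) (sc \<beta> 1)) |\<alpha> \<beta> x y. True}"
    (is "?L = sym_hom ` ?S")
  proof (intro equalityI subsetI)
    fix z assume "z \<in> ?L"
    then obtain \<alpha> \<beta> x y where "z = sym_hom (Poly_Mapping.single (h (sc \<alpha> x + sc \<beta> y)) 1 -
        (Poly_Mapping.single (h x) (sc \<alpha> 1) + Poly_Mapping.single (h y) (sc \<beta> 1)))"
      unfolding 2 carrier_eq by blast
    thus "z \<in> sym_hom ` ?S" by blast
  next
    fix z assume "z \<in> sym_hom ` ?S"
    then obtain \<alpha> \<beta> x y where "z = sym_hom (Poly_Mapping.single (h (sc \<alpha> x + sc \<beta> y)) 1 -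
        (Poly_Mapping.single (h x) (sc \<alpha> 1) + Poly_Mapping.single (h y) (sc \<beta> 1)))"
      by blast
    thus "z \<in> ?L" unfolding 2 carrier_eq by blast
  qed
  show ?thesis
    by (simp only: kaehler_relations_def Let_def rel_gens_def image_Un eq1 eq2)
qed

definition relations :: "('a \<Rightarrow>\<^sub>0 'n nc_poly) set"
  where "relations = {u \<in> symbols. sym_hom u \<in> kaehler_relations R}"

lemma relations_iff: "u \<in> symbols \<Longrightarrow> u \<in> relations \<longleftrightarrow> sym_hom u \<in> kaehler_relations R"
  by (simp add: relations_def)

text \<open>The Kaehler relations form the least submodule containing the generators, so they lie in
  the image of \<open>U\<close>. As \<open>U\<close> may fail to contain the kernel of
  \<open>sym_hom\<close>, only an element with the same image as \<open>u\<close> is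
  obtained.\<close>

lemma relations_induct:
  assumes "u \<in> relations" "symb.subspace U" "U \<subseteq> symbols" "\<And>a u. u \<in> U \<Longrightarrow> lmul a u \<in> U"
    and "rel_gens \<subseteq> U"
  shows "\<exists>v\<in>U. sym_hom u = sym_hom v"
proof -
  have "kaehler_relations R \<subseteq> sym_hom ` U"
    unfolding kaehler_relations_eq lin_span_def
    using submodule_sym_image[OF assms(2-4)] assms(5) by (intro Inter_lower) auto
  thus ?thesis using assms(1) by (auto simp: relations_def)
qed

lemma submodule_vimage:
  assumes "submodule H R (symbol_module R)"
  shows "symb.subspace {u \<in> symbols. sym_hom u \<in> H}"
    and "u \<in> symbols \<Longrightarrow> sym_hom u \<in> H \<Longrightarrow> sym_hom (lmul a u) \<in> H"
proof -
  interpret H: submodule H R "symbol_module R" by fact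
  show *: "u \<in> symbols \<Longrightarrow> sym_hom u \<in> H \<Longrightarrow> sym_hom (lmul a u) \<in> H" for u a
    by (simp add: sym_hom_lmul hom_closed)
  show "symb.subspace {u \<in> symbols. sym_hom u \<in> H}"
    using H.subgroup_axioms *
    by (intro sym.subspace_vimage_subgroup) (auto simp: subgroup_sym_space)
qed

lemma in_relations_iff:
  "u \<in> relations \<longleftrightarrow>
    u \<in> symbols \<and> (\<forall>H. submodule H R (symbol_module R) \<longrightarrow> sym_hom ` rel_gens \<subseteq> H \<longrightarrow> sym_hom u \<in> H)"
  by (auto simp: relations_def kaehler_relations_eq lin_span_def)

lemma subspace_relations: "symb.subspace relations"
proof -
  have *: "symb.subspace {u \<in> symbols. sym_hom u \<in> H}" if "submodule H R (symbol_module R)" for H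
    using that by (rule submodule_vimage)
  show ?thesis
  proof (rule symb.subspaceI)
    show "0 \<in> relations"
      using symb.subspace_0[OF *] sym.V_closed(1) by (simp add: in_relations_iff)
    show "u + v \<in> relations" if "u \<in> relations" "v \<in> relations" for u v
      using that symb.subspace_add[OF *, of _ u v] sym.V_closed(2)[of u v] by (simp add: in_relations_iff)
    show "lmul (Poly_Mapping.single 0 c) u \<in> relations" if "u \<in> relations" for u c
      using that symb.subspace_scale[OF *, of _ u c] sym.V_closed(3)[of u c] by (simp add: in_relations_iff)
  qed
qed

lemma lmul_in_relations: "u \<in> relations \<Longrightarrow> lmul a u \<in> relations"
  using submodule_vimage(2)[of _ u a] lmul_in_symbols[of u a] by (simp add: in_relations_iff)

lemma rel_gens_subset_relations: "rel_gens \<subseteq> relations"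
proof
  fix u assume u: "u \<in> rel_gens"
  hence "u \<in> symbols" using rel_gens_subset by (rule subsetD[rotated])
  thus "u \<in> relations" using u by (auto simp: in_relations_iff)
qed

lemma relations_subset: "relations \<subseteq> symbols"
  by (auto simp: relations_def)

lemma sym_hom_relations: "sym_hom ` relations = kaehler_relations R"
proof
  have "submodule (sym_hom ` symbols) R (symbol_module R)"
    using subspace_symbols lmul_in_symbols by (intro submodule_sym_image) auto
  hence "kaehler_relations R \<subseteq> sym_hom ` symbols"
    unfolding kaehler_relations_eq lin_span_def using rel_gens_subset by (intro Inter_lower) auto
  thus "kaehler_relations R \<subseteq> sym_hom ` relations"
    by (auto simp: relations_def)
qed (auto simp: relations_def)

lemma sym_hom_eq_0_in_relations:
  assumes "u \<in> symbols" "\<And>f. h (Poly_Mapping.lookup u f) = \<zero>\<^bsub>R\<^esub>"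
  shows "u \<in> relations"
proof -
  have "sym_hom u = sym_hom 0"
    using assms(2) by (simp add: sym_hom_def hom_zero)
  hence "sym_hom u \<in> sym_hom ` relations"
    using symb.subspace_0[OF subspace_relations] by simp
  thus ?thesis
    using assms(1) by (simp only: sym_hom_relations relations_iff)
qed

text \<open>The coefficient \<open>z * x\<close> has the order required by the axiom
  \<open>leibniz\<close> of \<open>cyclic_cocycle\<close>. Multiplying a generator by
  \<open>x\<close> gives \<open>x * z\<close> instead; the difference vanishes in \<open>R\<close>
  and is therefore a relation.\<close>

lemma product_rule:
  "Poly_Mapping.single (h (y * z)) x - Poly_Mapping.single (h z) (x * y) - Poly_Mapping.single (h y) (z * x) \<in> relations"
proof -
  have "Poly_Mapping.single (h (y * z)) 1 - (Poly_Mapping.single (h z) y + Poly_Mapping.single (h y) z) \<in> relations"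
    using rel_gens_subset_relations by (auto simp: rel_gens_def)
  hence "lmul x (Poly_Mapping.single (h (y * z)) 1 - (Poly_Mapping.single (h z) y + Poly_Mapping.single (h y) z)) \<in> relations"
    by (rule lmul_in_relations)
  moreover have "Poly_Mapping.single (h y) (x * z - z * x) \<in> relations"
    by (intro sym_hom_eq_0_in_relations single_in_symbols)
      (simp add: lookup_single when_def hom_zero hom_diff hom_closed comm[of x z] M.r_neg a_minus_def)
  ultimately have "lmul x (Poly_Mapping.single (h (y * z)) 1 - (Poly_Mapping.single (h z) y + Poly_Mapping.single (h y) z)) +
      Poly_Mapping.single (h y) (x * z - z * x) \<in> relations"
    by (rule symb.subspace_add[OF subspace_relations])
  thus ?thesis
    by (simp add: lmul_diff lmul_add lmul_single single_diff)
qed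

lemma linear_rule:
  "Poly_Mapping.single (h (sc \<alpha> y + sc \<beta> z)) x - Poly_Mapping.single (h y) (sc \<alpha> x) - Poly_Mapping.single (h z) (sc \<beta> x) \<in> relations"
proof -
  have "Poly_Mapping.single (h (sc \<alpha> y + sc \<beta> z)) 1 -
      (Poly_Mapping.single (h y) (sc \<alpha> 1) + Poly_Mapping.single (h z) (sc \<beta> 1)) \<in> relations"
    using rel_gens_subset_relations unfolding rel_gens_def by blast
  hence "lmul x (Poly_Mapping.single (h (sc \<alpha> y + sc \<beta> z)) 1 -
      (Poly_Mapping.single (h y) (sc \<alpha> 1) + Poly_Mapping.single (h z) (sc \<beta> 1))) \<in> relations"
    by (rule lmul_in_relations)
  thus ?thesis
    by (simp only: lmul_diff lmul_add lmul_single sc_mult_right mult_1_right diff_diff_eq)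
qed

lemma linear_rule_add:
  "Poly_Mapping.single (h (y + z)) x - Poly_Mapping.single (h y) x - Poly_Mapping.single (h z) x \<in> relations"
  using linear_rule[of 1 y 1 z x] by simp

lemma linear_rule_scale:
  "Poly_Mapping.single (h (sc c y)) x - Poly_Mapping.single (h y) (sc c x) \<in> relations"
  using linear_rule[of c y 0 y x] by simp

section \<open>Differentials as classes of symbols\<close>

lemma Omega1_space_eq: "Omega1_space R = quot sym_space (kaehler_relations R)"
  by (simp add: Omega1_space_def Omega1_def quot_def FactRing_def sym_space_def ring.defs module.defs
      A_RCOSETS_def' a_r_coset_def' set_add_def' rcoset_mult_def fun_eq_iff)

definition omega :: "('a \<Rightarrow>\<^sub>0 'n nc_poly) \<Rightarrow> ('a \<Rightarrow> 'a) set"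
  where "omega u = kaehler_relations R +>\<^bsub>sym_space\<^esub> sym_hom u"

sublocale omega: presentation "\<lambda>c. Poly_Mapping.map ((*) (Poly_Mapping.single 0 c))" symbols omega "Omega1_space R"
  unfolding omega_def[abs_def] Omega1_space_eq sym_hom_relations[symmetric]
  by (rule presentation_quot[OF sym.presentation_axioms subspace_relations relations_subset])

lemma omega_eq_0_iff: "u \<in> symbols \<Longrightarrow> omega u = \<zero>\<^bsub>Omega1_space R\<^esub> \<longleftrightarrow> u \<in> relations"
  using sym.coset_eq_iff[OF subspace_relations relations_subset, of u 0] sym.V_closed(1)
  unfolding omega.hom_zero[symmetric] omega_def sym_hom_relations by (simp add: relations_iff)

lemma omega_eq_iff: "u \<in> symbols \<Longrightarrow> v \<in> symbols \<Longrightarrow> omega u = omega v \<longleftrightarrow> u - v \<in> relations"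
  by (simp add: omega.hom_eq_iff omega_eq_0_iff sym.V_closed)

lemma coset_symbol_module: "W +>\<^bsub>symbol_module R\<^esub> x = W +>\<^bsub>sym_space\<^esub> x"
  by (simp add: a_r_coset_def' sym_space_simps)

lemma kaehler_d_eq: "kaehler_d R (h x) = omega (Poly_Mapping.single (h x) 1)"
  by (simp add: kaehler_d_def omega_def coset_symbol_module sym_hom_single hom_one)

lemma smult_kaehler_d: "h a \<odot>\<^bsub>Omega1 R\<^esub> kaehler_d R (h x) = omega (Poly_Mapping.single (h x) a)"
proof -
  have "kaehler_d R (h x) = (\<lambda>u. sym_hom (u + Poly_Mapping.single (h x) 1)) ` relations"
    unfolding kaehler_d_eq omega_def sym_hom_relations[symmetric]
    by (intro sym.coset_image relations_subset single_in_symbols)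
  moreover have "kaehler_relations R +>\<^bsub>symbol_module R\<^esub>
      (h a \<odot>\<^bsub>symbol_module R\<^esub> sym_hom (u + Poly_Mapping.single (h x) 1)) = omega (Poly_Mapping.single (h x) a)"
    if "u \<in> relations" for u
  proof -
    have "kaehler_relations R +>\<^bsub>symbol_module R\<^esub>
        (h a \<odot>\<^bsub>symbol_module R\<^esub> sym_hom (u + Poly_Mapping.single (h x) 1)) =
        omega (lmul a u + Poly_Mapping.single (h x) a)"
      by (simp add: omega_def coset_symbol_module lmul_add lmul_single flip: sym_hom_lmul)
    also have "\<dots> = omega (Poly_Mapping.single (h x) a)"
      using lmul_in_relations[OF that, of a] relations_subset
      by (subst omega_eq_iff) (auto simp: sym.V_closed single_in_symbols)
    finally show ?thesis .
  qed
  moreover have "relations \<noteq> {}" using symb.subspace_0[OF subspace_relations] by auto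
  ultimately show ?thesis
    by (simp add: Omega1_def quot_simps)
qed

section \<open>Exact differentials\<close>

definition exact_symbols :: "('a \<Rightarrow>\<^sub>0 'n nc_poly) set"
  where "exact_symbols = {u \<in> symbols. \<exists>x. u - Poly_Mapping.single (h x) 1 \<in> relations}"

lemma exact_symbols_subset: "exact_symbols \<subseteq> symbols"
  by (auto simp: exact_symbols_def)

lemma relations_subset_exact: "relations \<subseteq> exact_symbols"
proof
  fix u assume u: "u \<in> relations"
  \<comment> \<open>The witness for exactness is \<open>d0\<close>: additivity at
    \<open>0 + 0\<close> makes the symbol of \<open>d0\<close> itself a relation.\<close>
  have "- Poly_Mapping.single (h (0 + 0)) 1 \<in> relations"
    using linear_rule_add[of 0 0 1] by simp
  hence "u + - Poly_Mapping.single (h (0 + 0)) 1 \<in> relations"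
    by (rule symb.subspace_add[OF subspace_relations u])
  thus "u \<in> exact_symbols"
    using u relations_subset by (auto simp: exact_symbols_def)
qed

lemma subspace_exact_symbols: "symb.subspace exact_symbols"
proof (intro symb.subspaceI)
  show "0 \<in> exact_symbols"
    using symb.subspace_0[OF subspace_relations] relations_subset_exact by blast
next
  fix u v assume uv: "u \<in> exact_symbols" "v \<in> exact_symbols"
  then obtain x y where xy: "u - Poly_Mapping.single (h x) 1 \<in> relations" "v - Poly_Mapping.single (h y) 1 \<in> relations"
    by (auto simp: exact_symbols_def)
  have "(u - Poly_Mapping.single (h x) 1) + (v - Poly_Mapping.single (h y) 1) -
      (Poly_Mapping.single (h (x + y)) 1 - Poly_Mapping.single (h x) 1 - Poly_Mapping.single (h y) 1) \<in> relations"
    by (intro symb.subspace_diff symb.subspace_add subspace_relations xy linear_rule_add)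
  hence "(u + v) - Poly_Mapping.single (h (x + y)) 1 \<in> relations"
    by (simp add: algebra_simps)
  thus "u + v \<in> exact_symbols"
    using uv by (auto simp: exact_symbols_def sym.V_closed)
next
  fix u c assume u: "u \<in> exact_symbols"
  then obtain x where x: "u - Poly_Mapping.single (h x) 1 \<in> relations"
    by (auto simp: exact_symbols_def)
  have "lmul (Poly_Mapping.single 0 c) (u - Poly_Mapping.single (h x) 1) -
      (Poly_Mapping.single (h (sc c x)) 1 - Poly_Mapping.single (h x) (sc c 1)) \<in> relations"
    by (intro symb.subspace_diff symb.subspace_scale subspace_relations x linear_rule_scale)
  also have "lmul (Poly_Mapping.single 0 c) (u - Poly_Mapping.single (h x) 1) -
      (Poly_Mapping.single (h (sc c x)) 1 - Poly_Mapping.single (h x) (sc c 1)) =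
      lmul (Poly_Mapping.single 0 c) u - Poly_Mapping.single (h (sc c x)) 1"
    by (simp add: lmul_diff lmul_single sc_conv_mult)
  finally show "lmul (Poly_Mapping.single 0 c) u \<in> exact_symbols"
    using u by (auto simp: exact_symbols_def sym.V_closed)
qed

lemma kaehler_d_image: "kaehler_d R ` carrier R = omega ` exact_symbols"
proof (intro equalityI subsetI)
  fix z assume "z \<in> kaehler_d R ` carrier R"
  then obtain x where "z = omega (Poly_Mapping.single (h x) 1)"
    by (auto simp: carrier_eq kaehler_d_eq)
  moreover have "Poly_Mapping.single (h x) 1 \<in> exact_symbols"
    using symb.subspace_0[OF subspace_relations]
    by (auto simp: exact_symbols_def single_in_symbols intro!: exI[of _ x])
  ultimately show "z \<in> omega ` exact_symbols" by blast
next
  fix z assume "z \<in> omega ` exact_symbols"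
  then obtain u x where "u \<in> symbols" "z = omega u" "u - Poly_Mapping.single (h x) 1 \<in> relations"
    by (auto simp: exact_symbols_def)
  hence "z = kaehler_d R (h x)"
    by (simp add: kaehler_d_eq omega_eq_iff single_in_symbols)
  thus "z \<in> kaehler_d R ` carrier R" by (simp add: carrier_eq)
qed

definition omega_mod_exact :: "('a \<Rightarrow>\<^sub>0 'n nc_poly) \<Rightarrow> ('a \<Rightarrow> 'a) set set"
  where "omega_mod_exact u = kaehler_d R ` carrier R +>\<^bsub>Omega1_space R\<^esub> omega u"

lemma presentation_omega_mod_exact:
  "presentation (\<lambda>c. Poly_Mapping.map ((*) (Poly_Mapping.single 0 c))) symbols omega_mod_exact (Omega1_mod_exact R)"
  unfolding omega_mod_exact_def[abs_def] Omega1_mod_exact_def kaehler_d_image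
  by (rule presentation_quot[OF omega.presentation_axioms subspace_exact_symbols exact_symbols_subset])

lemma omega_mod_exact_eq_0_iff:
  assumes "u \<in> symbols"
  shows "omega_mod_exact u = \<zero>\<^bsub>Omega1_mod_exact R\<^esub> \<longleftrightarrow> u \<in> exact_symbols"
proof -
  interpret T: presentation "\<lambda>c. Poly_Mapping.map ((*) (Poly_Mapping.single 0 c))" symbols omega_mod_exact "Omega1_mod_exact R"
    by (rule presentation_omega_mod_exact)
  have "omega_mod_exact u = \<zero>\<^bsub>Omega1_mod_exact R\<^esub> \<longleftrightarrow> omega u \<in> omega ` exact_symbols"
    using omega.coset_eq_iff[OF subspace_exact_symbols exact_symbols_subset assms sym.V_closed(1)]
    by (simp add: omega_mod_exact_def kaehler_d_image flip: T.hom_zero)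
  also have "\<dots> \<longleftrightarrow> u \<in> exact_symbols"
  proof
    assume "omega u \<in> omega ` exact_symbols"
    then obtain v where v: "v \<in> exact_symbols" "omega u = omega v" by auto
    hence "u - v \<in> relations"
      using omega_eq_iff[OF assms, of v] exact_symbols_subset by blast
    hence "u - v \<in> exact_symbols"
      using relations_subset_exact by blast
    hence "(u - v) + v \<in> exact_symbols"
      by (rule symb.subspace_add[OF subspace_exact_symbols _ v(1)])
    thus "u \<in> exact_symbols" by simp
  qed auto
  finally show ?thesis .
qed

end

section \<open>Homogeneous components\<close>

lemma homogeneous_iff: "a \<in> homogeneous k \<longleftrightarrow> (\<forall>w. length (letters w) \<noteq> k \<longrightarrow> Poly_Mapping.lookup a w = 0)"
  by (auto simp: homogeneous_def in_keys_iff)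

lemma subspace_homogeneous: "nc.subspace (homogeneous k)"
  by (intro nc.subspaceI) (auto simp: homogeneous_iff lookup_add lookup_map_times)

lemma homogeneous_mult:
  assumes "a \<in> homogeneous i" "b \<in> homogeneous j"
  shows "a * b \<in> homogeneous (i + j)"
  using keys_mult[of a b] assms by (fastforce simp: homogeneous_def plus_free_monoid_def)

lemma ncmon_homogeneous: "ncmon w \<in> homogeneous (length w)"
  by (simp add: homogeneous_def ncmon_def)

definition proj :: "nat \<Rightarrow> 'n nc_poly \<Rightarrow> 'n nc_poly"
  where "proj k a = Abs_poly_mapping (\<lambda>w. if length (letters w) = k then Poly_Mapping.lookup a w else 0)"

lemma lookup_proj:
  "Poly_Mapping.lookup (proj k a) w = (if length (letters w) = k then Poly_Mapping.lookup a w else 0)"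
proof -
  have "finite {w. (if length (letters w) = k then Poly_Mapping.lookup a w else 0) \<noteq> 0}"
    by (rule finite_subset[of _ "Poly_Mapping.keys a"]) (auto simp: in_keys_iff)
  thus ?thesis by (simp add: proj_def lookup_Abs_poly_mapping)
qed

lemma proj_add: "proj k (a + b) = proj k a + proj k b"
  by (rule poly_mapping_eqI) (simp add: lookup_proj lookup_add)

lemma proj_diff: "proj k (a - b) = proj k a - proj k b"
  by (rule poly_mapping_eqI) (simp add: lookup_proj lookup_minus)

lemma proj_sc: "proj k (sc c a) = sc c (proj k a)"
  by (rule poly_mapping_eqI) (simp add: lookup_proj lookup_map_times)

lemma proj_zero: "proj k 0 = 0"
  by (rule poly_mapping_eqI) (simp add: lookup_proj)

lemma proj_homogeneous: "a \<in> homogeneous j \<Longrightarrow> proj k a = (if j = k then a else 0)"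
  by (rule poly_mapping_eqI) (auto simp: lookup_proj homogeneous_iff)

text \<open>For words \<open>u\<close>, \<open>v\<close> the product \<open>u P v\<close> is
  homogeneous, so \<open>proj k\<close> keeps or kills it. Linearity in \<open>v\<close> and then in
  \<open>u\<close> extends this to the spanning set of the ideal.\<close>

lemma proj_in_ideal_of:
  assumes "P \<in> homogeneous d" "x \<in> ideal_of P"
  shows "proj k x \<in> ideal_of P"
proof -
  note sub = nc.subspace_0[OF subspace_ideal_of] nc.subspace_add[OF subspace_ideal_of]
    nc.subspace_scale[OF subspace_ideal_of]
  have "proj k (ncmon u * P * ncmon v) \<in> ideal_of P" for u v
  proof -
    have "ncmon u * P * ncmon v \<in> homogeneous (length u + d + length v)"
      by (intro homogeneous_mult ncmon_homogeneous assms(1))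
    thus ?thesis
      by (simp add: proj_homogeneous sandwich_in_ideal_of sub(1))
  qed
  moreover have "nc.subspace {v. proj k (u * P * v) \<in> ideal_of P}" for u
    by (intro nc.subspaceI) (simp_all add: distrib_left sc_mult_right proj_add proj_sc proj_zero sub)
  ultimately have "v \<in> {v. proj k (ncmon u * P * v) \<in> ideal_of P}" for u v
    by - (rule nc_subspace_ncmon_UNIV, simp_all)
  moreover have "nc.subspace {u. proj k (u * P * v) \<in> ideal_of P}" for v
    by (intro nc.subspaceI) (simp_all add: distrib_right sc_mult_left proj_add proj_sc proj_zero sub)
  ultimately have "u \<in> {u. proj k (u * P * v) \<in> ideal_of P}" for u v
    by - (rule nc_subspace_ncmon_UNIV, simp_all)
  hence "ideal_of P \<subseteq> {x. proj k x \<in> ideal_of P}"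
    unfolding ideal_of_def[of P]
    by (intro nc.span_minimal nc.subspaceI)
      (auto simp: proj_add proj_sc proj_zero nc.span_zero nc.span_add nc.span_scale)
  thus ?thesis using assms(2) by auto
qed

text \<open>The same pairs \<open>(a, b)\<close> index the generators \<open>[a, b]\<close> of the
  degree \<open>k\<close> part of \<open>L2\<close> and the generators \<open>a db\<close> of that
  of \<open>\<Omega>\<^sup>1\<close>; the two gradings are compared through them.\<close>

definition bidegree :: "nat \<Rightarrow> ('n nc_poly \<times> 'n nc_poly) set"
  where "bidegree k = {(a, b). \<exists>i j. a \<in> homogeneous i \<and> b \<in> homogeneous j \<and> i + j = k}"

definition commutator_span :: "('n nc_poly \<times> 'n nc_poly) set \<Rightarrow> 'n nc_poly set"
  where "commutator_span S = nc.span ((\<lambda>(a, b). commutator a b) ` S)"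

lemma commutator_span_UNIV: "commutator_span UNIV = L2"
  unfolding commutator_span_def L2_def by (rule arg_cong[of _ _ nc.span]) auto

lemma commutator_span_subset: "commutator_span S \<subseteq> L2"
  unfolding commutator_span_UNIV[symmetric] commutator_span_def by (intro nc.span_mono) auto

lemma commutator_span_bidegree: "commutator_span (bidegree k) \<subseteq> homogeneous k"
proof -
  have "commutator a b \<in> homogeneous (i + j)" if "a \<in> homogeneous i" "b \<in> homogeneous j" for a b i j
    using homogeneous_mult[OF that] homogeneous_mult[OF that(2,1)]
    unfolding commutator_def add.commute[of j] by (rule nc.subspace_diff[OF subspace_homogeneous])
  thus ?thesis
    unfolding commutator_span_def
    by (intro nc.span_minimal subspace_homogeneous) (auto simp: bidegree_def)
qed

lemma commutator_in_span: "(a, b) \<in> S \<Longrightarrow> commutator a b \<in> commutator_span S"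
  unfolding commutator_span_def by (rule nc.span_base) force

lemma subspace_commutator_span: "nc.subspace (commutator_span S)"
  by (simp add: commutator_span_def)

lemma commutator_add_left: "commutator (a + b) c = commutator a c + commutator b c"
  by (simp add: commutator_def algebra_simps)

lemma commutator_add_right: "commutator a (b + c) = commutator a b + commutator a c"
  by (simp add: commutator_def algebra_simps)

lemma commutator_sc_left: "commutator (sc k a) b = sc k (commutator a b)"
  by (simp add: commutator_def sc_mult_left sc_mult_right nc.scale_right_diff_distrib)

lemma commutator_sc_right: "commutator a (sc k b) = sc k (commutator a b)"
  by (simp add: commutator_def sc_mult_left sc_mult_right nc.scale_right_diff_distrib)

lemma commutator_zero_left: "commutator 0 b = 0"
  by (simp add: commutator_def)

lemma commutator_zero_right: "commutator b 0 = 0"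
  by (simp add: commutator_def)

text \<open>Commutators of words are homogeneous and span \<open>L2\<close>, and the projection
  keeps or kills each of them.\<close>

lemma proj_L2:
  assumes "x \<in> L2"
  shows "proj k x \<in> commutator_span (bidegree k)"
proof -
  let ?S = "commutator_span (bidegree k)"
  note sub = nc.subspace_0[OF subspace_commutator_span] nc.subspace_add[OF subspace_commutator_span]
    nc.subspace_scale[OF subspace_commutator_span]
  have "proj k (commutator (ncmon u) (ncmon v)) \<in> ?S" for u v
  proof (cases "length u + length v = k")
    case True
    hence "(ncmon u, ncmon v) \<in> bidegree k"
      using ncmon_homogeneous[of u] ncmon_homogeneous[of v] by (auto simp: bidegree_def)
    hence "commutator (ncmon u) (ncmon v) \<in> ?S" by (rule commutator_in_span)
    moreover from this have "commutator (ncmon u) (ncmon v) \<in> homogeneous k"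
      using commutator_span_bidegree by blast
    ultimately show ?thesis by (simp add: proj_homogeneous)
  next
    case False
    have "(ncmon u, ncmon v) \<in> bidegree (length u + length v)"
      using ncmon_homogeneous[of u] ncmon_homogeneous[of v] by (auto simp: bidegree_def)
    hence "commutator (ncmon u) (ncmon v) \<in> homogeneous (length u + length v)"
      using commutator_span_bidegree commutator_in_span by blast
    thus ?thesis using False by (simp add: proj_homogeneous sub(1))
  qed
  moreover have "nc.subspace {v. proj k (commutator u v) \<in> ?S}" for u
    by (intro nc.subspaceI)
      (simp_all add: commutator_add_right commutator_sc_right commutator_zero_right proj_add proj_sc proj_zero sub)
  ultimately have "v \<in> {v. proj k (commutator (ncmon u) v) \<in> ?S}" for u v
    by - (rule nc_subspace_ncmon_UNIV, simp_all)
  moreover have "nc.subspace {u. proj k (commutator u v) \<in> ?S}" for v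
    by (intro nc.subspaceI)
      (simp_all add: commutator_add_left commutator_sc_left commutator_zero_left proj_add proj_sc proj_zero sub)
  ultimately have "u \<in> {u. proj k (commutator u v) \<in> ?S}" for u v
    by - (rule nc_subspace_ncmon_UNIV, simp_all)
  moreover have "nc.subspace {x. proj k x \<in> ?S}"
    by (intro nc.subspaceI) (simp_all add: proj_add proj_sc proj_zero sub)
  ultimately have "L2 \<subseteq> {x. proj k x \<in> ?S}"
    unfolding L2_def by (intro nc.span_minimal) auto
  thus ?thesis using assms by auto
qed

section \<open>One relation with nonzero abelianization\<close>

lemma in_sums_iff: "x \<in> {a + b |a b. a \<in> S \<and> b \<in> T} \<longleftrightarrow> (\<exists>a\<in>S. x - a \<in> T)"
  for x :: "'b :: ab_group_add"
proof
  assume "\<exists>a\<in>S. x - a \<in> T"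
  then obtain a where "a \<in> S" "x - a \<in> T" by blast
  moreover have "x = a + (x - a)" by simp
  ultimately show "x \<in> {a + b |a b. a \<in> S \<and> b \<in> T}" by blast
next
  assume "x \<in> {a + b |a b. a \<in> S \<and> b \<in> T}"
  then obtain a b where "a \<in> S" "b \<in> T" "x = a + b" by blast
  thus "\<exists>a\<in>S. x - a \<in> T" by (intro bexI[of _ a]) simp_all
qed

locale abelian_relator =
  fixes P :: "'n::finite nc_poly" and d :: nat and idx :: "'n \<Rightarrow> nat"
  assumes card: "CARD('n) \<le> 3"
    and homogeneous: "P \<in> homogeneous d"
    and inj: "inj idx"
    and ab_nonzero: "ab idx P \<noteq> 0"
begin

text \<open>\<open>W\<close> and \<open>K\<close> are kernels computed in the free algebra:
  \<open>L2\<close> modulo its intersection with \<open>W\<close> is \<open>B\<^sub>2(A)\<close>,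
  and \<open>K\<close> is the kernel of the map onto the abelianization of \<open>A\<close>.\<close>

definition W :: "'n nc_poly set"
  where "W = {l + i |l i. l \<in> L3 \<and> i \<in> ideal_of P}"

definition K :: "'n nc_poly set"
  where "K = {m + i |m i. m \<in> M2 \<and> i \<in> ideal_of P}"

lemma subspace_W: "nc.subspace W"
  unfolding W_def by (intro nc.subspace_sums subspace_L3 subspace_ideal_of)

lemma M2_subset_K: "M2 \<subseteq> K"
  unfolding K_def in_sums_iff subset_iff
  using nc.subspace_0[OF subspace_ideal_of] by (metis diff_self)

lemma ideal_subset_K: "ideal_of P \<subseteq> K"
  unfolding K_def in_sums_iff subset_iff
  using nc.subspace_0[OF subspace_M2] by (metis diff_zero)

text \<open>The bound on the number of generators enters here: \<open>[M2, F]\<close> lies in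
  \<open>L3\<close>, while \<open>[I, F]\<close> lies in \<open>I\<close> for any ideal
  \<open>I\<close>.\<close>

lemma commutator_K_in_W:
  assumes "k \<in> K"
  shows "commutator k a \<in> W" "commutator a k \<in> W"
proof -
  obtain m i where mi: "m \<in> M2" "i \<in> ideal_of P" "k = m + i" using assms by (auto simp: K_def)
  have "commutator i a \<in> ideal_of P"
    unfolding commutator_def using mi(2)
    by (intro nc.subspace_diff[OF subspace_ideal_of] ideal_of_mult)
  thus "commutator k a \<in> W"
    using commutator_M2_in_L3[OF card mi(1), of a] by (auto simp: W_def mi(3) commutator_add_left)
  hence "- commutator k a \<in> W" by (rule nc.subspace_neg[OF subspace_W])
  thus "commutator a k \<in> W" by (simp add: commutator_def)
qed

section \<open>The one-relator algebra and its abelianization as quotients\<close>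

definition A_hom :: "'n nc_poly \<Rightarrow> 'n nc_poly set"
  where "A_hom x = ideal_of P +>\<^bsub>free_algebra\<^esub> x"

sublocale A: nc_quotient A_hom "one_relator P"
  using nc_quotient_quot[OF free.nc_quotient_axioms subspace_ideal_of[of P] ideal_of_mult]
  by (simp add: one_relator_def genideal_free_algebra A_hom_def[abs_def])

lemma A_hom_eq_iff: "A_hom x = A_hom y \<longleftrightarrow> x - y \<in> ideal_of P"
  using free.coset_eq_iff[OF subspace_ideal_of, of P x y] by (simp add: A_hom_def)

definition R_hom :: "'n nc_poly \<Rightarrow> 'n nc_poly set set"
  where "R_hom x = commutator_ideal (one_relator P) +>\<^bsub>one_relator P\<^esub> A_hom x"

lemma R_quotient: "nc_quotient R_hom (abelianization (one_relator P))"
  using nc_quotient_quot[OF A.nc_quotient_axioms subspace_M2 M2_mult]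
  by (simp add: abelianization_def A.commutator_ideal R_hom_def[abs_def])

lemma R_hom_eq_iff: "R_hom x = R_hom y \<longleftrightarrow> x - y \<in> K"
proof -
  have "R_hom x = R_hom y \<longleftrightarrow> (\<exists>m\<in>M2. x - y - m \<in> ideal_of P)"
    using A.coset_eq_iff[OF subspace_M2, of x y]
    by (auto simp: R_hom_def A.commutator_ideal image_iff A_hom_eq_iff)
  also have "\<dots> \<longleftrightarrow> x - y \<in> K"
    unfolding K_def in_sums_iff ..
  finally show ?thesis .
qed

sublocale R: nc_comm_quotient R_hom "abelianization (one_relator P)"
proof (intro nc_comm_quotient.intro nc_comm_quotient_axioms.intro R_quotient)
  fix x y
  have "commutator x y \<in> K"
    using commutator_in_L2 L2_subset_M2 M2_subset_K by blast
  thus "R_hom (x * y) = R_hom (y * x)"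
    by (simp add: R_hom_eq_iff commutator_def)
qed

definition rep :: "'n nc_poly set set \<Rightarrow> 'n nc_poly"
  where "rep = inv_into UNIV R_hom"

lemma R_hom_rep: "f \<in> carrier (abelianization (one_relator P)) \<Longrightarrow> R_hom (rep f) = f"
  by (auto simp: rep_def R.carrier_eq f_inv_into_f)

lemma rep_R_hom: "rep (R_hom x) - x \<in> K"
  by (simp add: R_hom_rep R.hom_closed flip: R_hom_eq_iff)

text \<open>The map \<open>a df \<mapsto> [a, f]\<close>, with \<open>f\<close> lifted to the free
  algebra by an arbitrary choice. Modulo \<open>W\<close> the choice does not matter, by
  \<open>br_single_R_hom\<close>.\<close>

definition br :: "('n nc_poly set set \<Rightarrow>\<^sub>0 'n nc_poly) \<Rightarrow> 'n nc_poly"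
  where "br u = (\<Sum>f\<in>Poly_Mapping.keys u. commutator (Poly_Mapping.lookup u f) (rep f))"

lemma br_superset:
  assumes "finite S" "Poly_Mapping.keys u \<subseteq> S"
  shows "br u = (\<Sum>f\<in>S. commutator (Poly_Mapping.lookup u f) (rep f))"
  unfolding br_def using assms
  by (intro sum.mono_neutral_left) (auto simp: in_keys_iff commutator_zero_left)

lemma br_add: "br (u + v) = br u + br v"
  unfolding br_def
  by (rule setsum_keys_plus_distrib) (auto simp: commutator_add_left commutator_zero_left)

lemma br_diff: "br (u - v) = br u - br v"
  using br_add[of "u - v" v] by simp

lemma br_zero: "br 0 = 0"
  by (simp add: br_def)

lemma br_single: "br (Poly_Mapping.single f a) = commutator a (rep f)"
  by (simp add: br_superset[of "{f}"])

lemma br_scale: "br (lmul (Poly_Mapping.single 0 c) u) = sc c (br u)"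
proof -
  have "Poly_Mapping.keys (lmul (Poly_Mapping.single 0 c) u) \<subseteq> Poly_Mapping.keys u"
    by (auto simp: in_keys_iff lookup_map_times)
  thus ?thesis
    by (subst br_superset[of "Poly_Mapping.keys u"])
      (simp_all add: br_def lookup_map_times commutator_sc_left nc.scale_sum_right flip: sc_conv_mult)
qed

lemma br_in_L2: "br u \<in> L2"
  unfolding br_def by (intro nc.subspace_sum[OF subspace_L2] commutator_in_L2)

lemma br_in_W_if_coeffs_in_K: "(\<And>f. Poly_Mapping.lookup u f \<in> K) \<Longrightarrow> br u \<in> W"
  unfolding br_def by (intro nc.subspace_sum[OF subspace_W] commutator_K_in_W)

lemma br_single_R_hom: "br (Poly_Mapping.single (R_hom x) a) - commutator a x \<in> W"
proof -
  have "commutator a (rep (R_hom x) - x) \<in> W"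
    by (intro commutator_K_in_W rep_R_hom)
  thus ?thesis by (simp add: br_single commutator_def algebra_simps)
qed

text \<open>
  Closing the condition under multiplication by \<open>a\<close> is what makes it an \<open>R\<close>-submodule, as needed to
  compare it with the Kaehler relations.
\<close>

lemma br_relations:
  assumes "u \<in> R.relations"
  shows "br u \<in> W"
proof -
  define U where "U = {u \<in> R.symbols. \<forall>a. br (lmul a u) \<in> W}"
  have "symb.subspace U"
  proof (intro symb.subspaceI)
    show "0 \<in> U"
      by (simp add: U_def R.sym.V_closed lmul_zero br_zero nc.subspace_0[OF subspace_W])
    show "x + y \<in> U" if "x \<in> U" "y \<in> U" for x y
      using that by (simp add: U_def R.sym.V_closed lmul_add br_add nc.subspace_add[OF subspace_W])
    show "lmul (Poly_Mapping.single 0 c) x \<in> U" if "x \<in> U" for c x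
      using that by (simp add: U_def R.sym.V_closed lmul_scalar br_scale nc.subspace_scale[OF subspace_W])
  qed
  moreover have "U \<subseteq> R.symbols" by (auto simp: U_def)
  moreover have "lmul a u \<in> U" if "u \<in> U" for a u
    using that by (simp add: U_def R.lmul_in_symbols lmul_lmul)
  moreover have "R.rel_gens \<subseteq> U"
  proof
    have split: "br (lmul a (Poly_Mapping.single (R_hom x) b - (Poly_Mapping.single (R_hom y) c + Poly_Mapping.single (R_hom z) e))) \<in> W"
      if "commutator (a * b) x - (commutator (a * c) y + commutator (a * e) z) \<in> W" for a b c e x y z
    proof -
      have "(br (Poly_Mapping.single (R_hom x) (a * b)) - commutator (a * b) x) -
          ((br (Poly_Mapping.single (R_hom y) (a * c)) - commutator (a * c) y) +
           (br (Poly_Mapping.single (R_hom z) (a * e)) - commutator (a * e) z)) +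
          (commutator (a * b) x - (commutator (a * c) y + commutator (a * e) z)) \<in> W"
        by (intro nc.subspace_add[OF subspace_W] nc.subspace_diff[OF subspace_W] br_single_R_hom that)
      thus ?thesis
        by (simp add: lmul_diff lmul_add lmul_single br_diff br_add algebra_simps)
    qed
    fix u assume "u \<in> R.rel_gens"
    then consider x y where "u = Poly_Mapping.single (R_hom (x * y)) 1 - (Poly_Mapping.single (R_hom y) x + Poly_Mapping.single (R_hom x) y)"
      | \<alpha> \<beta> x y where "u = Poly_Mapping.single (R_hom (sc \<alpha> x + sc \<beta> y)) 1 -
          (Poly_Mapping.single (R_hom x) (sc \<alpha> 1) + Poly_Mapping.single (R_hom y) (sc \<beta> 1))"
      unfolding R.rel_gens_def by blast
    thus "u \<in> U"
    proof cases
      case 1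
      \<comment> \<open>The failure of the product rule for brackets is a triple commutator.\<close>
      have "commutator (a * 1) (x * y) - (commutator (a * x) y + commutator (a * y) x) = commutator (commutator y a) x" for a
        by (simp add: commutator_def algebra_simps)
      moreover have "commutator (commutator y a) x \<in> W" for a
        using commutator_in_L2 L2_subset_M2 M2_subset_K by (intro commutator_K_in_W) blast
      ultimately have "br (lmul a u) \<in> W" for a
        unfolding 1 by (intro split) simp
      thus ?thesis
        by (simp add: U_def 1 R.sym.V_closed R.single_in_symbols)
    next
      case 2
      have "commutator (a * 1) (sc \<alpha> x + sc \<beta> y) - (commutator (a * sc \<alpha> 1) x + commutator (a * sc \<beta> 1) y) = 0" for a
        by (simp only: commutator_add_right commutator_sc_right sc_mult_right commutator_sc_left mult_1_right diff_self)
      hence "br (lmul a u) \<in> W" for a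
        unfolding 2 by (intro split) (simp only: nc.subspace_0[OF subspace_W])
      thus ?thesis
        by (simp only: U_def 2 R.sym.V_closed R.single_in_symbols mem_Collect_eq simp_thms)
    qed
  qed
  ultimately obtain v where v: "v \<in> U" "R.sym_hom u = R.sym_hom v"
    using R.relations_induct[OF assms] by blast
  \<comment> \<open>\<open>u\<close> and \<open>v\<close> agree only as symbols over the
    abelianization, so their coefficients differ by elements of \<open>K\<close>.\<close>
  have "br (u - v) \<in> W"
  proof (rule br_in_W_if_coeffs_in_K)
    fix f
    have "R_hom (Poly_Mapping.lookup u f) = R_hom (Poly_Mapping.lookup v f)"
      using v(2) by (auto simp: R.sym_hom_def dest: fun_cong)
    thus "Poly_Mapping.lookup (u - v) f \<in> K"
      by (simp add: lookup_minus R_hom_eq_iff)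
  qed
  moreover have "br v \<in> W"
    using v(1) by (auto simp: U_def lmul_one dest: spec[of _ 1])
  ultimately have "br (u - v) + br v \<in> W" by (intro nc.subspace_add[OF subspace_W])
  thus ?thesis by (simp add: br_diff)
qed

lemma br_exact:
  assumes "u \<in> R.exact_symbols"
  shows "br u \<in> W"
proof -
  obtain x where x: "u - Poly_Mapping.single (R_hom x) 1 \<in> R.relations"
    using assms by (auto simp: R.exact_symbols_def)
  hence "br (u - Poly_Mapping.single (R_hom x) 1) \<in> W" by (rule br_relations)
  thus ?thesis by (simp add: br_diff br_single commutator_def)
qed

text \<open>A functional \<open>t\<close> that kills exact symbols but not \<open>u\<close> gives
  the cyclic cocycle \<open>b x y = t(x dy)\<close>. Its potential satisfies
  \<open>pot (br u) = t u\<close>, yet by \<open>pot_eq_0\<close> it vanishes on elements of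
  \<open>L2\<close> that lie in \<open>W\<close>.\<close>

lemma exact_if_br:
  assumes "u \<in> R.symbols" "br u \<in> W"
  shows "u \<in> R.exact_symbols"
proof (rule ccontr)
  assume "u \<notin> R.exact_symbols"
  then obtain t where "Vector_Spaces.linear (\<lambda>c. lmul (Poly_Mapping.single 0 c)) (*) t"
      and t0: "\<forall>v\<in>R.exact_symbols. t v = 0" and tu: "t u \<noteq> 0"
    using symb.subspace_separation[OF R.subspace_exact_symbols] by blast
  interpret t: Vector_Spaces.linear "\<lambda>c. lmul (Poly_Mapping.single 0 c)" "(*)" t by fact
  define b where "b x y = t (Poly_Mapping.single (R_hom y) x)" for x y
  have rel: "t v = 0" if "v \<in> R.relations" for v
    using that t0 R.relations_subset_exact by blast
  interpret b: cyclic_cocycle b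
  proof
    fix x y z c
    show "b (x + y) z = b x z + b y z"
      by (simp add: b_def single_add t.add)
    show "b x (y + z) = b x y + b x z"
      using rel[OF R.linear_rule_add[of y z x]] by (simp add: b_def t.diff t.add algebra_simps)
    show "b (sc c x) y = c * b x y"
      unfolding b_def t.scale[symmetric] lmul_single sc_conv_mult ..
    show "b x (sc c y) = c * b x y"
    proof -
      have "b x (sc c y) = b (sc c x) y"
        using rel[OF R.linear_rule_scale[of c y x]] by (simp add: b_def t.diff)
      also have "\<dots> = c * b x y"
        unfolding b_def t.scale[symmetric] lmul_single sc_conv_mult ..
      finally show ?thesis .
    qed
    show "b x (y * z) = b (x * y) z + b (z * x) y"
      using rel[OF R.product_rule[of y z x]] by (simp add: b_def t.diff t.add algebra_simps)
    have "Poly_Mapping.single (R_hom x) 1 \<in> R.exact_symbols"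
      using symb.subspace_0[OF R.subspace_relations]
      by (auto simp: R.exact_symbols_def R.single_in_symbols intro!: exI[of _ x])
    thus "b 1 x = 0"
      using t0 by (simp add: b_def)
  qed
  have bK: "b k x = 0" if "k \<in> K" for k x
    unfolding b_def
  proof (intro rel R.sym_hom_eq_0_in_relations R.single_in_symbols)
    fix f
    have "R_hom k = R_hom 0" using that by (simp add: R_hom_eq_iff)
    thus "R_hom (Poly_Mapping.lookup (Poly_Mapping.single (R_hom x) k) f) = \<zero>\<^bsub>abelianization (one_relator P)\<^esub>"
      by (simp add: lookup_single when_def R.hom_zero)
  qed
  obtain l i where "br u = l + i" "l \<in> L3" "i \<in> ideal_of P"
    using assms(2) by (auto simp: W_def)
  hence "b.pot (br u) = 0"
    using bK M2_subset_K ideal_subset_K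
    by (intro b.pot_eq_0[OF homogeneous inj ab_nonzero _ _ br_in_L2]) blast+
  moreover have "b.pot (br u) = t u"
  proof -
    have pot_sum: "b.pot (sum g S) = (\<Sum>x\<in>S. b.pot (g x))" for g :: "'n nc_poly set set \<Rightarrow> _" and S
      using b.pot_sc[of 0 0] by (induction S rule: infinite_finite_induct) (simp_all add: b.pot_add)
    have "b.pot (br u) = (\<Sum>f\<in>Poly_Mapping.keys u. b (Poly_Mapping.lookup u f) (rep f))"
      by (simp add: br_def pot_sum b.pot_commutator)
    also have "\<dots> = (\<Sum>f\<in>Poly_Mapping.keys u. t (Poly_Mapping.single f (Poly_Mapping.lookup u f)))"
      using assms(1) by (intro sum.cong) (auto simp: b_def R_hom_rep R.symbols_def)
    also have "\<dots> = t u"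
      by (subst (3) poly_mapping_eq_sum_single[of u]) (simp add: t.sum)
    finally show ?thesis .
  qed
  ultimately show False using tu by simp
qed

section \<open>Matching the homogeneous components\<close>

definition symbol_span :: "('n nc_poly \<times> 'n nc_poly) set \<Rightarrow> ('n nc_poly set set \<Rightarrow>\<^sub>0 'n nc_poly) set"
  where "symbol_span S = symb.span ((\<lambda>(a, b). Poly_Mapping.single (R_hom b) a) ` S)"

lemma symbol_span_subset: "symbol_span S \<subseteq> R.symbols"
  unfolding symbol_span_def
  by (intro symb.span_minimal R.subspace_symbols) (auto simp: R.single_in_symbols)

lemma br_symbol_span:
  assumes "u \<in> symbol_span S"
  shows "\<exists>y\<in>commutator_span S. br u - y \<in> W"
proof -
  let ?T = "{u. \<exists>y\<in>commutator_span S. br u - y \<in> W}"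
  have "symb.subspace ?T"
  proof (intro symb.subspaceI)
    show "0 \<in> ?T"
      using nc.subspace_0[OF subspace_W] nc.subspace_0[OF subspace_commutator_span]
      by (auto simp: br_zero intro!: bexI[of _ 0])
  next
    fix u v assume "u \<in> ?T" "v \<in> ?T"
    then obtain x y where xy: "x \<in> commutator_span S" "y \<in> commutator_span S" "br u - x \<in> W" "br v - y \<in> W"
      by auto
    hence "(br u - x) + (br v - y) \<in> W" "x + y \<in> commutator_span S"
      by (auto intro: nc.subspace_add[OF subspace_W] nc.subspace_add[OF subspace_commutator_span])
    thus "u + v \<in> ?T" by (auto simp: br_add algebra_simps intro!: bexI[of _ "x + y"])
  next
    fix u c assume "u \<in> ?T"
    then obtain x where x: "x \<in> commutator_span S" "br u - x \<in> W" by auto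
    hence "sc c (br u - x) \<in> W" "sc c x \<in> commutator_span S"
      by (auto intro: nc.subspace_scale[OF subspace_W] nc.subspace_scale[OF subspace_commutator_span])
    thus "lmul (Poly_Mapping.single 0 c) u \<in> ?T"
      by (auto simp: br_scale nc.scale_right_diff_distrib intro!: bexI[of _ "sc c x"])
  qed
  moreover have "(\<lambda>(a, b). Poly_Mapping.single (R_hom b) a) ` S \<subseteq> ?T"
    using br_single_R_hom commutator_in_span by fastforce
  ultimately have "symbol_span S \<subseteq> ?T"
    unfolding symbol_span_def by (intro symb.span_minimal)
  thus ?thesis using assms by auto
qed

text \<open>For \<open>S = UNIV\<close> this gives surjectivity of \<open>br\<close> onto
  \<open>L2\<close> modulo \<open>W\<close>; for \<open>S = bidegree k\<close> it gives surjectivity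
  in degree \<open>k\<close>.\<close>

lemma commutator_span_lift:
  assumes "y \<in> commutator_span S"
  shows "\<exists>u\<in>symbol_span S. br u - y \<in> W"
proof -
  let ?T = "{y. \<exists>u\<in>symbol_span S. br u - y \<in> W}"
  have "nc.subspace ?T"
  proof (intro nc.subspaceI)
    show "0 \<in> ?T"
      using nc.subspace_0[OF subspace_W] symb.span_zero
      by (auto simp: br_zero symbol_span_def intro!: bexI[of _ 0])
  next
    fix x y assume "x \<in> ?T" "y \<in> ?T"
    then obtain u v where uv: "u \<in> symbol_span S" "v \<in> symbol_span S" "br u - x \<in> W" "br v - y \<in> W"
      by auto
    hence "(br u - x) + (br v - y) \<in> W" "u + v \<in> symbol_span S"
      by (auto simp: symbol_span_def intro: nc.subspace_add[OF subspace_W] symb.span_add)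
    thus "x + y \<in> ?T" by (auto simp: br_add algebra_simps intro!: bexI[of _ "u + v"])
  next
    fix x c assume "x \<in> ?T"
    then obtain u where u: "u \<in> symbol_span S" "br u - x \<in> W" by auto
    hence "sc c (br u - x) \<in> W" "lmul (Poly_Mapping.single 0 c) u \<in> symbol_span S"
      by (auto simp: symbol_span_def intro: nc.subspace_scale[OF subspace_W] symb.span_scale)
    thus "sc c x \<in> ?T"
      by (auto simp: br_scale nc.scale_right_diff_distrib intro!: bexI[of _ "lmul (Poly_Mapping.single 0 c) u"])
  qed
  moreover have "commutator a b \<in> ?T" if "(a, b) \<in> S" for a b
  proof -
    have "Poly_Mapping.single (R_hom b) a \<in> symbol_span S"
      unfolding symbol_span_def by (rule symb.span_base) (use that in force)
    thus ?thesis using br_single_R_hom by blast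
  qed
  ultimately have "commutator_span S \<subseteq> ?T"
    unfolding commutator_span_def by (intro nc.span_minimal) auto
  thus ?thesis using assms by auto
qed

section \<open>The second lower central quotient presented by symbols\<close>

definition B2_hom :: "'n nc_poly \<Rightarrow> 'n nc_poly set set"
  where "B2_hom x = lcs (one_relator P) 3 +>\<^bsub>(one_relator P)\<lparr>carrier := lcs (one_relator P) 2\<rparr>\<^esub> A_hom x"

lemma presentation_L2: "presentation sc L2 A_hom ((one_relator P)\<lparr>carrier := lcs (one_relator P) 2\<rparr>)"
  unfolding A.lcs_2 by (intro A.presentation_subspace subspace_L2 subset_UNIV)

lemma presentation_B2_L2: "presentation sc L2 B2_hom (lcs_quot (one_relator P) 2)"
  using presentation_quot[OF presentation_L2 subspace_L3 L3_subset_L2]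
  by (simp add: lcs_quot_def B2_hom_def[abs_def] A.lcs_3)

lemma B2_hom_eq_iff:
  assumes "x \<in> L2" "y \<in> L2"
  shows "B2_hom x = B2_hom y \<longleftrightarrow> x - y \<in> W"
proof -
  interpret L: presentation sc L2 A_hom "(one_relator P)\<lparr>carrier := lcs (one_relator P) 2\<rparr>"
    by (rule presentation_L2)
  have "B2_hom x = B2_hom y \<longleftrightarrow> (\<exists>l\<in>L3. x - y - l \<in> ideal_of P)"
    using L.coset_eq_iff[OF subspace_L3 L3_subset_L2 assms]
    by (simp add: B2_hom_def A.lcs_3 image_iff A_hom_eq_iff)
  also have "\<dots> \<longleftrightarrow> x - y \<in> W"
    unfolding W_def in_sums_iff ..
  finally show ?thesis .
qed

lemma presentation_B2:
  "presentation (\<lambda>c. lmul (Poly_Mapping.single 0 c)) R.symbols (\<lambda>u. B2_hom (br u)) (lcs_quot (one_relator P) 2)"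
proof (rule presentation.presentation_comp[OF presentation_B2_L2])
  show "vector_space (\<lambda>c. lmul (Poly_Mapping.single 0 c) :: ('n nc_poly set set \<Rightarrow>\<^sub>0 'n nc_poly) \<Rightarrow> _)"
    by (rule symb.vector_space_axioms)
  show "B2_hom ` L2 \<subseteq> (\<lambda>u. B2_hom (br u)) ` R.symbols"
  proof
    fix z assume "z \<in> B2_hom ` L2"
    then obtain y where y: "y \<in> L2" "z = B2_hom y" by blast
    then obtain u where u: "u \<in> symbol_span UNIV" "br u - y \<in> W"
      using commutator_span_lift[of y UNIV] by (auto simp: commutator_span_UNIV)
    have "u \<in> R.symbols" using u(1) symbol_span_subset by blast
    moreover have "z = B2_hom (br u)" using u y B2_hom_eq_iff[of "br u" y] br_in_L2 by simp
    ultimately show "z \<in> (\<lambda>u. B2_hom (br u)) ` R.symbols" by blast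
  qed
qed (simp_all add: R.subspace_symbols br_add br_scale br_in_L2 image_subset_iff)

lemma A_grading: "one_relator_grading P k = A_hom ` homogeneous k"
  by (simp add: one_relator_grading_def quot_grading_def genideal_free_algebra A_hom_def[abs_def])

lemma R_grading: "abelianization_grading (one_relator P) (one_relator_grading P) k = R_hom ` homogeneous k"
  by (simp add: abelianization_grading_def quot_grading_def A_grading R_hom_def[abs_def] image_image)

lemma B2_grading:
  "lcs_quot_grading (one_relator P) (one_relator_grading P) 2 k = (\<lambda>u. B2_hom (br u)) ` symbol_span (bidegree k)"
proof -
  have "lcs_quot_grading (one_relator P) (one_relator_grading P) 2 k =
      (\<lambda>x. lcs (one_relator P) 3 +>\<^bsub>(one_relator P)\<lparr>carrier := lcs (one_relator P) 2\<rparr>\<^esub> x) `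
        (A_hom ` L2 \<inter> A_hom ` homogeneous k)"
    by (simp add: lcs_quot_grading_def quot_grading_def A_grading A.lcs_2)
  also have "A_hom ` L2 \<inter> A_hom ` homogeneous k = A_hom ` commutator_span (bidegree k)"
  proof (intro equalityI subsetI)
    fix z assume "z \<in> A_hom ` L2 \<inter> A_hom ` homogeneous k"
    then obtain x y where xy: "z = A_hom x" "z = A_hom y" "x \<in> L2" "y \<in> homogeneous k" by blast
    \<comment> \<open>\<open>x\<close> represents \<open>z\<close> in \<open>L2\<close>, and
      \<open>y\<close> represents it in degree \<open>k\<close>. The ideal is closed under
      \<open>proj k\<close>, so \<open>proj k x\<close> represents \<open>z\<close> too, and by
      \<open>proj_L2\<close> it is a combination of commutators of homogeneous elements.\<close>
    hence "proj k (x - y) \<in> ideal_of P"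
      by (intro proj_in_ideal_of[OF homogeneous]) (simp add: A_hom_eq_iff[symmetric])
    hence "A_hom (proj k x) = z"
      using xy by (simp add: proj_diff proj_homogeneous A_hom_eq_iff)
    thus "z \<in> A_hom ` commutator_span (bidegree k)"
      using proj_L2[OF xy(3), of k] by blast
  qed (use commutator_span_subset commutator_span_bidegree in blast)
  also have "(\<lambda>x. lcs (one_relator P) 3 +>\<^bsub>(one_relator P)\<lparr>carrier := lcs (one_relator P) 2\<rparr>\<^esub> x) ` \<dots> =
      B2_hom ` commutator_span (bidegree k)"
    by (simp add: image_image B2_hom_def[abs_def])
  also have "\<dots> = (\<lambda>u. B2_hom (br u)) ` symbol_span (bidegree k)"
  proof (intro equalityI subsetI)
    fix z assume "z \<in> B2_hom ` commutator_span (bidegree k)"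
    then obtain y where y: "y \<in> commutator_span (bidegree k)" "z = B2_hom y" by blast
    then obtain u where u: "u \<in> symbol_span (bidegree k)" "br u - y \<in> W"
      using commutator_span_lift by blast
    have "y \<in> L2" using y(1) commutator_span_subset by blast
    hence "z = B2_hom (br u)" using u y(2) B2_hom_eq_iff[of "br u" y] br_in_L2 by simp
    thus "z \<in> (\<lambda>u. B2_hom (br u)) ` symbol_span (bidegree k)" using u(1) by blast
  next
    fix z assume "z \<in> (\<lambda>u. B2_hom (br u)) ` symbol_span (bidegree k)"
    then obtain u where u: "u \<in> symbol_span (bidegree k)" "z = B2_hom (br u)" by blast
    then obtain y where y: "y \<in> commutator_span (bidegree k)" "br u - y \<in> W"
      using br_symbol_span by blast
    have "y \<in> L2" using y(1) commutator_span_subset by blast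
    hence "z = B2_hom y" using y u(2) B2_hom_eq_iff[of "br u" y] br_in_L2 by simp
    thus "z \<in> B2_hom ` commutator_span (bidegree k)" using y(1) by blast
  qed
  finally show ?thesis .
qed

lemma Omega1_grading_eq:
  "Omega1_grading (abelianization (one_relator P)) (abelianization_grading (one_relator P) (one_relator_grading P)) k =
    R.omega ` symbol_span (bidegree k)"
proof -
  let ?S = "{f \<odot>\<^bsub>Omega1 (abelianization (one_relator P))\<^esub> kaehler_d (abelianization (one_relator P)) g |f g i j.
      f \<in> R_hom ` homogeneous i \<and> g \<in> R_hom ` homogeneous j \<and> i + j = k}"
  let ?T = "(\<lambda>(a, b). Poly_Mapping.single (R_hom b) a) ` bidegree k"
  have "?S = R.omega ` ?T"
  proof (intro equalityI subsetI)
    fix z assume "z \<in> ?S"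
    then obtain a b i j where "z = R.omega (Poly_Mapping.single (R_hom b) a)"
        "a \<in> homogeneous i" "b \<in> homogeneous j" "i + j = k"
      using R.smult_kaehler_d by force
    thus "z \<in> R.omega ` ?T" by (force simp: bidegree_def)
  next
    fix z assume "z \<in> R.omega ` ?T"
    then obtain a b i j where "z = R_hom a \<odot>\<^bsub>Omega1 (abelianization (one_relator P))\<^esub> kaehler_d (abelianization (one_relator P)) (R_hom b)"
        "a \<in> homogeneous i" "b \<in> homogeneous j" "i + j = k"
      unfolding R.smult_kaehler_d bidegree_def by force
    thus "z \<in> ?S" by blast
  qed
  moreover have "?T \<subseteq> R.symbols" by (auto simp: R.single_in_symbols)
  ultimately show ?thesis
    unfolding Omega1_grading_def R_grading symbol_span_def
    by (simp only: R.omega.lin_span_image)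
qed

text \<open>Both sides are presented by the symbols: \<open>a df\<close> goes to the class of
  \<open>[a, f]\<close> on the left and to its own class on the right. Both kernels equal
  \<open>R.exact_symbols\<close>, and in both cases degree \<open>k\<close> is the image of
  \<open>symbol_span (bidegree k)\<close>.\<close>

theorem graded_iso_B2_Omega1_mod_exact:
  "\<exists>\<phi>. graded_iso (lcs_quot (one_relator P) 2)
      (lcs_quot_grading (one_relator P) (one_relator_grading P) 2)
      (Omega1_mod_exact (abelianization (one_relator P)))
      (Omega1_mod_exact_grading (abelianization (one_relator P))
        (abelianization_grading (one_relator P) (one_relator_grading P))) \<phi>"
proof (rule graded_iso_presentations[OF presentation_B2 R.presentation_omega_mod_exact,
      where E = "\<lambda>k. symbol_span (bidegree k)"])
  fix u assume u: "u \<in> R.symbols"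
  interpret B2: presentation "\<lambda>c. lmul (Poly_Mapping.single 0 c)" R.symbols "\<lambda>u. B2_hom (br u)" "lcs_quot (one_relator P) 2"
    by (rule presentation_B2)
  have "B2_hom (br u) = \<zero>\<^bsub>lcs_quot (one_relator P) 2\<^esub> \<longleftrightarrow> br u \<in> W"
    using B2_hom_eq_iff[OF br_in_L2 br_in_L2, of u 0] by (simp add: br_zero flip: B2.hom_zero)
  also have "\<dots> \<longleftrightarrow> u \<in> R.exact_symbols"
    using br_exact exact_if_br u by blast
  finally show "B2_hom (br u) = \<zero>\<^bsub>lcs_quot (one_relator P) 2\<^esub> \<longleftrightarrow>
      R.omega_mod_exact u = \<zero>\<^bsub>Omega1_mod_exact (abelianization (one_relator P))\<^esub>"
    by (simp add: R.omega_mod_exact_eq_0_iff u)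
next
  fix k
  show "Omega1_mod_exact_grading (abelianization (one_relator P))
        (abelianization_grading (one_relator P) (one_relator_grading P)) k =
      R.omega_mod_exact ` symbol_span (bidegree k)"
    by (simp add: Omega1_mod_exact_grading_def quot_grading_def Omega1_grading_eq image_image
        R.omega_mod_exact_def[abs_def])
qed (simp_all add: symbol_span_subset B2_grading)

end

theorem theorem1p1:
  fixes d :: nat
  assumes "CARD('n::finite) \<in> {2, 3}"
  shows "for_generic_homogeneous d (\<lambda>P :: 'n nc_poly.
    let A = one_relator P;
        A_gr = one_relator_grading P;
        \<Omega>0 = abelianization A;
        \<Omega>0_gr = abelianization_grading A A_gr
    in \<exists>\<phi>. graded_iso (lcs_quot A 2) (lcs_quot_grading A A_gr 2)
             (Omega1_mod_exact \<Omega>0) (Omega1_mod_exact_grading \<Omega>0 \<Omega>0_gr) \<phi>)"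
proof -
  obtain idx :: "'n \<Rightarrow> nat" where idx: "inj idx"
    using finite_imp_inj_to_nat_seg[of "UNIV :: 'n set"] by auto
  \<comment> \<open>The exceptional set is the hyperplane on which the coefficient of
    \<open>x^d\<close> vanishes, for one fixed letter \<open>x\<close>. By
    \<open>lookup_ab_power\<close> this coefficient survives abelianization, so off the hyperplane
    \<open>P\<close> has nonzero image.\<close>
  define w :: "'n free_monoid" where "w = Word (replicate d undefined)"
  define Z where "Z = {P \<in> homogeneous d. Poly_Mapping.lookup P w = 0}"
  have "zariski_closed d Z"
    unfolding zariski_closed_def Z_def
    by (intro exI[of _ "{\<lambda>P. Poly_Mapping.lookup P w}"]) (auto intro: polynomial_functions.coord)
  moreover have "Z \<subset> homogeneous d"
  proof -
    have "Poly_Mapping.single w 1 \<in> homogeneous d - Z"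
      by (simp add: Z_def homogeneous_def w_def)
    moreover have "Z \<subseteq> homogeneous d" by (auto simp: Z_def)
    ultimately show ?thesis by blast
  qed
  moreover have "\<exists>\<phi>. graded_iso (lcs_quot (one_relator P) 2)
      (lcs_quot_grading (one_relator P) (one_relator_grading P) 2)
      (Omega1_mod_exact (abelianization (one_relator P)))
      (Omega1_mod_exact_grading (abelianization (one_relator P))
        (abelianization_grading (one_relator P) (one_relator_grading P))) \<phi>"
    if P: "P \<in> homogeneous d - Z" for P
  proof -
    have "Poly_Mapping.lookup (ab idx P) (exponents idx (replicate d undefined)) \<noteq> 0"
      using P by (auto simp: lookup_ab_power[OF idx] Z_def w_def)
    hence "ab idx P \<noteq> 0" by auto
    then interpret abelian_relator P d idx
      using assms P idx by unfold_locales auto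
    show ?thesis by (rule graded_iso_B2_Omega1_mod_exact)
  qed
  ultimately show ?thesis
    unfolding for_generic_homogeneous_def Let_def by blast
qed

end
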